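(* Let $K$ be a field and let $\Delta_1\neq\{\emptyset\}$ and $\Delta_2\neq\{\emptyset\}$ be simplicial complexes with disjoint finite vertex sets $V(\Delta_1)$ and $V(\Delta_2)$. Assume that for $i=1,2$ one has $\{j\}\in\Delta_i$ for all $j\in V(\Delta_i)$. Let $\Delta_1\cup\Delta_2$ be the disjoint union. (a) The following conditions are equivalent: (1) $\Delta_1\cup\Delta_2$ is inseparable; (2) $\Delta_1$ and $\Delta_2$ are simplices. (b) The following conditions are equivalent: (1) $\Delta_1\cup\Delta_2$ is rigid; (2) $\Delta_1\cup\Delta_2$ is $\emptyset$-rigid; (3) $\Delta_1$ and $\Delta_2$ are simplices with $\dim\Delta_1+\dim\Delta_2>0$.
   Context: A simplicial complex $\Delta$ on a finite vertex set $V=V(\Delta)$ is a collection of subsets of $V$ closed under taking subsets and containing $\emptyset$. $\Delta$ is a simplex if $\Delta=2^V$ is the set of all subsets of $V$; $\dim\Delta=\max\{|F|:F\in\Delta\}-1$. The disjoint union $\Delta_1\cup\Delta_2$ has vertex set $V(\Delta_1)\cup V(\Delta_2)$, and $F\in\Delta_1\cup\Delta_2$ iff $F\in\Delta_1$ or $F\in\Delta_2$. Let $S$ be the polynomial ring over $K$ with variables $x_v$, $v\in V$. The Stanley--Reisner ideal $I_\Delta\subseteq S$ is generated by the monomials $\prod_{v\in N}x_v$ with $N\subseteq V$, $N\notin\Delta$; $K[\Delta]=S/I_\Delta$. $T^1(\Delta)=T^1(K[\Delta])$ is the cokernel of $\delta^*:\mathrm{Der}_K(S)\to\mathrm{Hom}_S(I_\Delta,S/I_\Delta)$,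 $\delta^*(\partial)(f)=\partial f+I_\Delta$; it is $\mathbb Z^V$-graded (with $\deg x_v$ the $v$th canonical basis vector). $\Delta$ is rigid if $T^1(\Delta)=0$, and $\emptyset$-rigid if $T^1(\Delta)_{-\mathbf b}=0$ for all $\mathbf b\in\{0,1\}^V$. Separation: for a squarefree monomial ideal $I\subseteq S$ and a new indeterminate $y$, a monomial ideal $J\subseteq S[y]$ is a separation of $I$ for the variable $x_i$ if (i) $I$ is the image of $J$ under the $K$-algebra homomorphism $S[y]\to S$ sending $y\mapsto x_i$ and fixing all variables of $S$; (ii) $x_i$ divides some minimal monomial generator of $J$ and $y$ divides some minimal monomial generator of $J$; (iii) $y-x_i$ is a non-zero divisor on $S[y]/J$. $\Delta$ is separable if $I_\Delta$ admits a separation for some variable, and inseparable otherwise. *)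

theory Defs
  imports "HOL-Library.Poly_Mapping" "HOL-Algebra.QuotRing" "HOL-Algebra.Divisibility"
begin

subsection \<open>Simplicial complexes\<close>

definition simplicial_complex :: "'v set \<Rightarrow> 'v set set \<Rightarrow> bool" where
  "simplicial_complex V \<Delta> \<longleftrightarrow>
     finite V \<and> \<Delta> \<subseteq> Pow V \<and> {} \<in> \<Delta> \<and> (\<forall>F\<in>\<Delta>. \<forall>G. G \<subseteq> F \<longrightarrow> G \<in> \<Delta>)"

definition is_simplex :: "'v set \<Rightarrow> 'v set set \<Rightarrow> bool" where
  "is_simplex V \<Delta> \<longleftrightarrow> \<Delta> = Pow V"

definition complex_dim :: "'v set set \<Rightarrow> int" where
  "complex_dim \<Delta> = int (Max (card ` \<Delta>)) - 1"

subsection \<open>Polynomial rings\<close>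

text \<open>
  A polynomial is a finitely supported map from exponent vectors to coefficients. The ring
  \<open>poly_ring V\<close> consists of those polynomials in which only variables indexed by \<open>V\<close> occur;
  the coefficient field \<open>K\<close> is the type \<open>'k\<close>.
\<close>

type_synonym ('v, 'k) mpoly = "('v \<Rightarrow>\<^sub>0 nat) \<Rightarrow>\<^sub>0 'k"

definition const_poly :: "'k::field \<Rightarrow> ('v, 'k) mpoly" where
  "const_poly c = Poly_Mapping.single 0 c"

definition monom :: "('v \<Rightarrow>\<^sub>0 nat) \<Rightarrow> ('v, 'k::field) mpoly" where
  "monom m = Poly_Mapping.single m 1"

definition X :: "'v \<Rightarrow> ('v, 'k::field) mpoly" where
  "X v = monom (Poly_Mapping.single v 1)"

definition poly_ring :: "'v set \<Rightarrow> ('v, 'k::field) mpoly ring" where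
  "poly_ring V =
     \<lparr>carrier = {p. \<forall>m\<in>Poly_Mapping.keys p. Poly_Mapping.keys m \<subseteq> V}, monoid.mult = (*), one = 1, zero = 0, add = (+)\<rparr>"

definition monomials :: "'v set \<Rightarrow> ('v, 'k::field) mpoly set" where
  "monomials V = {monom m | m. Poly_Mapping.keys m \<subseteq> V}"

text \<open>The \<open>K\<close>-algebra homomorphism sending \<open>X v\<close> to \<open>f v\<close>.\<close>

definition alg_hom :: "('v \<Rightarrow> ('w, 'k::field) mpoly) \<Rightarrow> ('v, 'k) mpoly \<Rightarrow> ('w, 'k) mpoly" where
  "alg_hom f p =
     (\<Sum>m\<in>Poly_Mapping.keys p. const_poly (Poly_Mapping.lookup p m) * (\<Prod>v\<in>Poly_Mapping.keys m. f v ^ Poly_Mapping.lookup m v))"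

definition SR_ideal :: "'v set \<Rightarrow> 'v set set \<Rightarrow> ('v, 'k::field) mpoly set" where
  "SR_ideal V \<Delta> = Idl\<^bsub>poly_ring V\<^esub> {\<Prod>v\<in>N. X v | N. N \<subseteq> V \<and> N \<notin> \<Delta>}"

subsection \<open>The first cotangent module\<close>

definition derivations :: "'v set \<Rightarrow> (('v, 'k::field) mpoly \<Rightarrow> ('v, 'k) mpoly) set" where
  "derivations V =
     {d \<in> carrier (poly_ring V) \<rightarrow>\<^sub>E carrier (poly_ring V).
        (\<forall>p\<in>carrier (poly_ring V). \<forall>q\<in>carrier (poly_ring V). d (p + q) = d p + d q) \<and>
        (\<forall>c. \<forall>p\<in>carrier (poly_ring V). d (const_poly c * p) = const_poly c * d p) \<and>
        (\<forall>p\<in>carrier (poly_ring V). \<forall>q\<in>carrier (poly_ring V). d (p * q) = p * d q + q * d p)}"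

text \<open>
  \<open>Hom_quot R I\<close> is \<open>Hom_R(I, R/I)\<close>, as an abelian group written multiplicatively so that the
  library's quotient \<open>Mod\<close> applies. Maps are extensional on \<open>I\<close>.
\<close>

definition Hom_quot :: "('a, 'b) ring_scheme \<Rightarrow> 'a set \<Rightarrow> ('a \<Rightarrow> 'a set) monoid" where
  "Hom_quot R I =
     \<lparr>carrier = {\<phi> \<in> I \<rightarrow>\<^sub>E carrier (R Quot I).
        (\<forall>f\<in>I. \<forall>g\<in>I. \<phi> (f \<oplus>\<^bsub>R\<^esub> g) = \<phi> f \<oplus>\<^bsub>R Quot I\<^esub> \<phi> g) \<and>
        (\<forall>r\<in>carrier R. \<forall>f\<in>I. \<phi> (r \<otimes>\<^bsub>R\<^esub> f) = (I +>\<^bsub>R\<^esub> r) \<otimes>\<^bsub>R Quot I\<^esub> \<phi> f)},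
      monoid.mult = (\<lambda>\<phi> \<psi>. \<lambda>f\<in>I. \<phi> f \<oplus>\<^bsub>R Quot I\<^esub> \<psi> f),
      one = (\<lambda>f\<in>I. \<zero>\<^bsub>R Quot I\<^esub>)\<rparr>"

definition delta_star ::
    "'v set \<Rightarrow> ('v, 'k::field) mpoly set \<Rightarrow> (('v, 'k) mpoly \<Rightarrow> ('v, 'k) mpoly)
       \<Rightarrow> ('v, 'k) mpoly \<Rightarrow> ('v, 'k) mpoly set" where
  "delta_star V I d = (\<lambda>f\<in>I. I +>\<^bsub>poly_ring V\<^esub> d f)"

text \<open>
  The cokernel of \<open>\<delta>\<^sup>*\<close>. Its zero element is \<open>\<one>\<^bsub>T1 V I\<^esub>\<close>, because of the multiplicative notation.
\<close>

definition T1 ::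
    "'v set \<Rightarrow> ('v, 'k::field) mpoly set \<Rightarrow> (('v, 'k) mpoly \<Rightarrow> ('v, 'k) mpoly set) set monoid" where
  "T1 V I = Hom_quot (poly_ring V) I Mod (delta_star V I ` derivations V)"

text \<open>
  The multigrading: only the values on \<open>V\<close> of a degree \<open>a :: 'v \<Rightarrow> int\<close> matter. A homomorphism
  is homogeneous of degree \<open>a\<close> if it maps \<open>I\<^sub>c\<close> into \<open>(S/I)\<^sub>c\<^sub>+\<^sub>a\<close> for all \<open>c\<close>, and \<open>T1_comp V I a\<close> is
  the image in the cokernel of the homogeneous homomorphisms of degree \<open>a\<close>.
\<close>

definition poly_comp :: "'v set \<Rightarrow> ('v \<Rightarrow> int) \<Rightarrow> ('v, 'k::field) mpoly set" where
  "poly_comp V a =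
     {p \<in> carrier (poly_ring V). \<forall>m\<in>Poly_Mapping.keys p. \<forall>v\<in>V. int (Poly_Mapping.lookup m v) = a v}"

definition Hom_comp ::
    "'v set \<Rightarrow> ('v, 'k::field) mpoly set \<Rightarrow> ('v \<Rightarrow> int)
       \<Rightarrow> (('v, 'k) mpoly \<Rightarrow> ('v, 'k) mpoly set) set" where
  "Hom_comp V I a =
     {\<phi> \<in> carrier (Hom_quot (poly_ring V) I).
        \<forall>c. \<phi> ` (I \<inter> poly_comp V c)
              \<subseteq> (\<lambda>p. I +>\<^bsub>poly_ring V\<^esub> p) ` poly_comp V (\<lambda>v. c v + a v)}"

definition T1_comp ::
    "'v set \<Rightarrow> ('v, 'k::field) mpoly set \<Rightarrow> ('v \<Rightarrow> int)
       \<Rightarrow> (('v, 'k) mpoly \<Rightarrow> ('v, 'k) mpoly set) set set" where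
  "T1_comp V I a =
     (\<lambda>\<phi>. (delta_star V I ` derivations V) #>\<^bsub>Hom_quot (poly_ring V) I\<^esub> \<phi>) ` Hom_comp V I a"

definition rigid :: "'k::field itself \<Rightarrow> 'v set \<Rightarrow> 'v set set \<Rightarrow> bool" where
  "rigid K V \<Delta> \<longleftrightarrow>
     (let I = SR_ideal V \<Delta> :: ('v, 'k) mpoly set in carrier (T1 V I) = {\<one>\<^bsub>T1 V I\<^esub>})"

definition empty_rigid :: "'k::field itself \<Rightarrow> 'v set \<Rightarrow> 'v set set \<Rightarrow> bool" where
  "empty_rigid K V \<Delta> \<longleftrightarrow>
     (let I = SR_ideal V \<Delta> :: ('v, 'k) mpoly set in
        \<forall>b \<in> V \<rightarrow> {0, 1}. T1_comp V I (\<lambda>v. - b v) = {\<one>\<^bsub>T1 V I\<^esub>})"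

subsection \<open>Separability\<close>

definition monomial_ideal :: "'v set \<Rightarrow> ('v, 'k::field) mpoly set \<Rightarrow> bool" where
  "monomial_ideal V J \<longleftrightarrow> (\<exists>M \<subseteq> monomials V. J = Idl\<^bsub>poly_ring V\<^esub> M)"

text \<open>
  A monomial ideal has exactly one inclusion-minimal set of monomial generators; its elements are
  the minimal monomial generators.
\<close>

definition minimal_monomial_generator ::
    "'v set \<Rightarrow> ('v, 'k::field) mpoly set \<Rightarrow> ('v, 'k) mpoly \<Rightarrow> bool" where
  "minimal_monomial_generator V J g \<longleftrightarrow>
     (\<exists>M \<subseteq> monomials V. J = Idl\<^bsub>poly_ring V\<^esub> M \<and>
        (\<forall>N. N \<subset> M \<longrightarrow> J \<noteq> Idl\<^bsub>poly_ring V\<^esub> N) \<and> g \<in> M)"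

text \<open>
  The ring \<open>S[y]\<close> has variables \<open>X (Some v)\<close> for \<open>v \<in> V\<close>, playing the role of \<open>x\<^sub>v\<close>, and the new
  indeterminate \<open>y = X None\<close>.
\<close>

definition ext_vars :: "'v set \<Rightarrow> 'v option set" where
  "ext_vars V = insert None (Some ` V)"

definition is_separation ::
    "'v set \<Rightarrow> ('v, 'k::field) mpoly set \<Rightarrow> 'v \<Rightarrow> ('v option, 'k) mpoly set \<Rightarrow> bool" where
  "is_separation V I i J \<longleftrightarrow>
     (let R = poly_ring (ext_vars V) :: ('v option, 'k) mpoly ring; y = X None; x = X (Some i) in
        monomial_ideal (ext_vars V) J \<and>
        I = alg_hom (case_option (X i) X) ` J \<and>
        (\<exists>g. minimal_monomial_generator (ext_vars V) J g \<and> x divides\<^bsub>R\<^esub> g) \<and>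
        (\<exists>g. minimal_monomial_generator (ext_vars V) J g \<and> y divides\<^bsub>R\<^esub> g) \<and>
        (\<forall>q \<in> carrier (R Quot J).
           (J +>\<^bsub>R\<^esub> (y - x)) \<otimes>\<^bsub>R Quot J\<^esub> q = \<zero>\<^bsub>R Quot J\<^esub> \<longrightarrow> q = \<zero>\<^bsub>R Quot J\<^esub>))"

definition separable :: "'k::field itself \<Rightarrow> 'v set \<Rightarrow> 'v set set \<Rightarrow> bool" where
  "separable K V \<Delta> \<longleftrightarrow>
     (\<exists>i\<in>V. \<exists>J. is_separation V (SR_ideal V \<Delta> :: ('v, 'k) mpoly set) i J)"

abbreviation inseparable :: "'k::field itself \<Rightarrow> 'v set \<Rightarrow> 'v set set \<Rightarrow> bool" where
  "inseparable K V \<Delta> \<equiv> \<not> separable K V \<Delta>"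

end

theory Submission
  imports Defs
begin

text \<open>
  For a squarefree monomial ideal \<open>I\<close> everything can be read off from exponents. If \<open>\<Delta>\<^sub>1\<close> is not a
  simplex, let \<open>N\<close> be a minimal nonface of \<open>\<Delta>\<^sub>1\<close> and \<open>i \<in> N\<close>. The generators \<open>x\<^sub>i x\<^sub>q\<close> with \<open>q \<in> V\<^sub>2\<close>
  and the generator \<open>x\<^sup>N\<close> do not interact: replacing \<open>x\<^sub>i\<close> by \<open>y\<close> in the former only is a separation,
  and sending \<open>x\<^sub>i x\<^sub>q\<close> to \<open>x\<^sub>q\<close> and the other generators to 0 is a homomorphism of degree \<open>- e\<^sub>i\<close>. A
  derivation \<open>d\<close> inducing it would make the constant term of \<open>d x\<^sub>i\<close> equal to 1 because of \<open>x\<^sub>i x\<^sub>q\<close>, and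
  equal to 0 because of \<open>x\<^sup>N\<close>.

  If both complexes are simplices, \<open>I\<close> is generated by the \<open>x\<^sub>p x\<^sub>q\<close> with \<open>p \<in> V\<^sub>1\<close>, \<open>q \<in> V\<^sub>2\<close>. In a
  separation \<open>J\<close> for \<open>x\<^sub>i\<close>, \<open>i \<in> V\<^sub>1\<close>, regularity of \<open>y - x\<^sub>i\<close> forces that one of \<open>z = x\<^sub>i\<close>, \<open>z = y\<close> satisfies
  \<open>z x\<^sub>q \<in> J\<close> for all \<open>q\<close>; then the other one, \<open>w\<close>, divides no minimal generator \<open>g\<close>, since \<open>z g / w \<in> J\<close> and
  \<open>g \<in> J\<close> give \<open>g / w \<in> J\<close>. The syzygies between the \<open>x\<^sub>p x\<^sub>q\<close> show that, unless there are only two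
  vertices, any homomorphism \<open>\<phi>\<close> has the form \<open>\<phi> (x\<^sub>p x\<^sub>q) = x\<^sub>q h\<^sub>p + x\<^sub>p k\<^sub>q\<close> modulo \<open>I\<close>, so it is induced
  by the derivation \<open>\<Sum> h\<^sub>p \<partial>/\<partial>x\<^sub>p + \<Sum> k\<^sub>q \<partial>/\<partial>x\<^sub>q\<close>.
\<close>

subsection \<open>Spans of monomials\<close>

abbreviation keys :: "('a \<Rightarrow>\<^sub>0 'b::zero) \<Rightarrow> 'a set" where
  "keys \<equiv> Poly_Mapping.keys"

abbreviation lookup :: "('a \<Rightarrow>\<^sub>0 'b::zero) \<Rightarrow> 'a \<Rightarrow> 'b" where
  "lookup \<equiv> Poly_Mapping.lookup"

abbreviation single :: "'a \<Rightarrow> 'b::zero \<Rightarrow> 'a \<Rightarrow>\<^sub>0 'b" where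
  "single \<equiv> Poly_Mapping.single"

definition expo :: "'v set \<Rightarrow> ('v \<Rightarrow>\<^sub>0 nat) set" where
  "expo V = {m. keys m \<subseteq> V}"

text \<open>The polynomial ring, its monomial ideals and its multigraded components are all of this
  form, so membership becomes a condition on exponents.\<close>

definition polys :: "('v \<Rightarrow>\<^sub>0 nat) set \<Rightarrow> ('v, 'k::field) mpoly set" where
  "polys A = {p. keys p \<subseteq> A}"

text \<open>The \<open>K\<close>-linear extension of a map given on monomials. Substitutions of
  variables, vector fields and partial division by a monomial all arise this way.\<close>

definition lin :: "(('v \<Rightarrow>\<^sub>0 nat) \<Rightarrow> ('w, 'k::field) mpoly) \<Rightarrow> ('v, 'k) mpoly \<Rightarrow> ('w, 'k) mpoly" where
  "lin T p = (\<Sum>m\<in>keys p. const_poly (lookup p m) * T m)"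

lemma keys_exponent_add: "keys (m + n :: 'v \<Rightarrow>\<^sub>0 nat) = keys m \<union> keys n"
  by (auto simp: in_keys_iff lookup_add)

lemma expo_add [simp]: "m + n \<in> expo V \<longleftrightarrow> m \<in> expo V \<and> n \<in> expo V"
  by (auto simp: expo_def keys_exponent_add)

lemma expo_zero [simp]: "0 \<in> expo V"
  by (simp add: expo_def)

lemma expo_single [simp]: "single v (Suc n) \<in> expo V \<longleftrightarrow> v \<in> V"
  by (simp add: expo_def)

lemma const_poly_add: "const_poly (a + b) = const_poly a + const_poly b"
  by (simp add: const_poly_def single_add)

lemma const_poly_mult: "const_poly (a * b) = const_poly a * const_poly b"
  by (simp add: const_poly_def mult_single)

lemma const_poly_0 [simp]: "const_poly 0 = 0"
  by (simp add: const_poly_def)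

lemma const_poly_1 [simp]: "const_poly 1 = 1"
  by (simp add: const_poly_def)

lemma monom_add: "monom (m + n) = monom m * monom n"
  by (simp add: monom_def mult_single)

lemma monom_0 [simp]: "monom 0 = 1"
  by (simp add: monom_def)

lemma keys_monom [simp]: "keys (monom m :: ('v, 'k::field) mpoly) = {m}"
  by (simp add: monom_def)

lemma lookup_monom: "lookup (monom m) n = (if n = m then 1 else 0)"
  by (auto simp: monom_def lookup_single when_def)

lemma lookup_const_poly_mult [simp]: "lookup (const_poly c * p) m = c * lookup p m"
  unfolding const_poly_def mult_map_scale_conv_mult [symmetric]
  by (auto simp: Poly_Mapping.map.rep_eq when_def)

lemma const_poly_monom: "const_poly c * monom m = single m c"
  by (simp add: const_poly_def monom_def mult_single)

lemma polys_add: "p \<in> polys A \<Longrightarrow> q \<in> polys A \<Longrightarrow> p + q \<in> polys A"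
  using Poly_Mapping.keys_add [of p q] by (auto simp: polys_def)

lemma polys_0 [simp]: "0 \<in> polys A"
  by (simp add: polys_def)

lemma polys_const_mult: "p \<in> polys A \<Longrightarrow> const_poly c * p \<in> polys A"
  by (auto simp: polys_def in_keys_iff)

lemma polys_uminus: "p \<in> polys A \<Longrightarrow> - p \<in> polys A"
  by (auto simp: polys_def in_keys_iff)

lemma polys_diff: "p \<in> polys A \<Longrightarrow> q \<in> polys A \<Longrightarrow> p - q \<in> polys A"
  using polys_add [of p A "- q"] polys_uminus [of q A] by simp

lemma polys_sum: "(\<And>i. i \<in> B \<Longrightarrow> f i \<in> polys A) \<Longrightarrow> sum f B \<in> polys A"
  by (induction B rule: infinite_finite_induct) (auto intro: polys_add)

lemma monom_in_polys [simp]: "monom m \<in> polys A \<longleftrightarrow> m \<in> A"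
  by (simp add: polys_def)

lemma polys_mono: "A \<subseteq> B \<Longrightarrow> p \<in> polys A \<Longrightarrow> p \<in> polys B"
  by (auto simp: polys_def)

lemma polys_mult:
  assumes "p \<in> polys A" "q \<in> polys B" "\<And>a b. a \<in> A \<Longrightarrow> b \<in> B \<Longrightarrow> a + b \<in> C"
  shows "p * q \<in> polys C"
  using assms keys_mult [of p q] unfolding polys_def by blast

lemma polys_induct [consumes 1, case_names zero monom add]:
  assumes "p \<in> polys A"
    and "P 0"
    and "\<And>c m. m \<in> A \<Longrightarrow> P (const_poly c * monom m)"
    and add: "\<And>p q. p \<in> polys A \<Longrightarrow> q \<in> polys A \<Longrightarrow> P p \<Longrightarrow> P q \<Longrightarrow> P (p + q)"
  shows "P p"
proof -
  \<comment> \<open>Partial sums over subsets of the support stay in \<open>polys A\<close>, so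
    additivity can be applied one term at a time.\<close>
  have terms: "P (\<Sum>m\<in>B. const_poly (lookup p m) * monom m)" if "B \<subseteq> keys p" for B
    using finite_subset [OF that finite_keys] that
  proof (induction B)
    case empty
    show ?case using assms(2) by simp
  next
    case (insert m B)
    have "const_poly (lookup p m) * monom m \<in> polys A"
      using insert.prems assms(1) by (intro polys_const_mult) (auto simp: polys_def)
    moreover have "(\<Sum>m\<in>B. const_poly (lookup p m) * monom m) \<in> polys A"
      using insert.prems assms(1)
      by (intro polys_sum polys_const_mult) (auto simp: polys_def)
    ultimately show ?case
      using insert assms(1) by (auto simp: polys_def intro!: add [unfolded polys_def] assms(3))
  qed
  have "p = (\<Sum>m\<in>keys p. const_poly (lookup p m) * monom m)"
    by (rule poly_mapping_eqI) (auto simp: lookup_sum const_poly_monom lookup_single when_def in_keys_iff)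
  with terms [of "keys p"] show ?thesis by simp
qed

lemma mpoly_induct [case_names zero monom add]:
  assumes "P 0" "\<And>c m. P (const_poly c * monom m)" "\<And>p q. P p \<Longrightarrow> P q \<Longrightarrow> P (p + q)"
  shows "P (p :: ('v, 'k::field) mpoly)"
  by (rule polys_induct [of p UNIV]) (use assms in \<open>auto simp: polys_def\<close>)

lemma lin_superset:
  assumes "finite B" "keys p \<subseteq> B"
  shows "lin T p = (\<Sum>m\<in>B. const_poly (lookup p m) * T m)"
  unfolding lin_def using assms by (intro sum.mono_neutral_left) (auto simp: in_keys_iff)

lemma lin_0 [simp]: "lin T 0 = 0"
  by (simp add: lin_def)

lemma lin_add: "lin T (p + q) = lin T p + lin T q"
proof -
  have "keys (p + q) \<subseteq> keys p \<union> keys q" by (rule Poly_Mapping.keys_add)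
  then show ?thesis
    by (simp add: lin_superset [of "keys p \<union> keys q"] lookup_add const_poly_add
        distrib_right sum.distrib)
qed

lemma lin_const_mult: "lin T (const_poly c * p) = const_poly c * lin T p"
proof -
  have "keys (const_poly c * p) \<subseteq> keys p" by (auto simp: in_keys_iff)
  then show ?thesis
    by (simp add: lin_superset [of "keys p"] const_poly_mult sum_distrib_left mult.assoc)
qed

lemma lin_monom [simp]: "lin T (monom m) = T m"
  by (simp add: lin_def lookup_monom)

lemma lin_in_polys:
  assumes "p \<in> polys A" "\<And>m. m \<in> A \<Longrightarrow> T m \<in> polys B"
  shows "lin T p \<in> polys B"
  using assms unfolding lin_def by (intro polys_sum polys_const_mult) (auto simp: polys_def)

text \<open>Multiplication by a monomial is injective on exponents, so no terms cancel; the
  coefficient identity gives the inclusion that \<open>keys_mult\<close> does not.\<close>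

lemma keys_monom_mult: "keys (monom u * p) = (+) u ` keys p"
  and lookup_monom_mult_add [simp]: "lookup (monom u * p) (u + m) = lookup p m"
proof -
  show *: "lookup (monom u * p) (u + m) = lookup p m" for m
    by (induction p rule: mpoly_induct)
      (auto simp: mult.left_commute [of _ "const_poly _"] monom_add [symmetric] lookup_monom
        distrib_left lookup_add)
  show "keys (monom u * p) = (+) u ` keys p"
  proof
    show "keys (monom u * p) \<subseteq> (+) u ` keys p"
      using keys_mult [of "monom u" p] by auto
    show "(+) u ` keys p \<subseteq> keys (monom u * p)"
      by (auto simp: in_keys_iff *)
  qed
qed

lemma lookup_monom_mult_eq_0:
  assumes "\<And>k. m \<noteq> u + k" shows "lookup (monom u * p) m = 0"
  using keys_monom_mult [of u p] assms by (fastforce simp: in_keys_iff image_iff)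

section \<open>The polynomial ring as a commutative ring\<close>

lemma carrier_poly_ring: "carrier (poly_ring V) = polys (expo V)"
  by (auto simp: poly_ring_def polys_def expo_def)

lemma poly_ring_sel [simp]:
  "x \<otimes>\<^bsub>poly_ring V\<^esub> y = x * y" "x \<oplus>\<^bsub>poly_ring V\<^esub> y = x + y"
  "\<one>\<^bsub>poly_ring V\<^esub> = 1" "\<zero>\<^bsub>poly_ring V\<^esub> = 0"
  by (simp_all add: poly_ring_def)

lemma one_in_polys: "1 \<in> polys (expo V)"
  using monom_in_polys [of 0 "expo V"] by simp

lemma expo_polys_mult: "p \<in> polys (expo V) \<Longrightarrow> q \<in> polys (expo V) \<Longrightarrow> p * q \<in> polys (expo V)"
  by (rule polys_mult) auto

lemma cring_poly_ring: "cring (poly_ring V :: ('v, 'k::field) mpoly ring)"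
proof (rule cringI)
  show "abelian_group (poly_ring V :: ('v, 'k) mpoly ring)"
  proof (rule abelian_groupI)
    fix x :: "('v, 'k) mpoly"
    assume "x \<in> carrier (poly_ring V)"
    then show "\<exists>y\<in>carrier (poly_ring V). y \<oplus>\<^bsub>poly_ring V\<^esub> x = \<zero>\<^bsub>poly_ring V\<^esub>"
      by (intro bexI [of _ "- x"]) (auto simp: carrier_poly_ring polys_uminus)
  qed (auto simp: carrier_poly_ring polys_add algebra_simps)
  show "Group.comm_monoid (poly_ring V :: ('v, 'k) mpoly ring)"
    by (rule comm_monoidI)
      (auto simp: carrier_poly_ring one_in_polys algebra_simps intro: expo_polys_mult)
qed (auto simp: algebra_simps)

lemma poly_ring_minus:
  assumes "x \<in> carrier (poly_ring V)" "y \<in> carrier (poly_ring V)"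
  shows "x \<ominus>\<^bsub>poly_ring V\<^esub> y = x - y"
proof -
  interpret cring "poly_ring V" by (rule cring_poly_ring)
  have "\<ominus>\<^bsub>poly_ring V\<^esub> y = - y"
    by (rule minus_equality) (use assms in \<open>auto simp: carrier_poly_ring polys_uminus\<close>)
  then show ?thesis by (simp add: a_minus_def)
qed

lemma X_in_polys [simp]: "X v \<in> polys (expo V) \<longleftrightarrow> v \<in> V"
  by (simp add: X_def expo_def)

subsection \<open>Monomial ideals\<close>

text \<open>Exactly the exponent sets of monomial ideals, as \<open>monomial_ideal_iff\<close>
  shows; the empty set gives the zero ideal.\<close>

definition up_closed :: "'v set \<Rightarrow> ('v \<Rightarrow>\<^sub>0 nat) set \<Rightarrow> bool" where
  "up_closed V A \<longleftrightarrow> A \<subseteq> expo V \<and> (\<forall>m\<in>A. \<forall>u\<in>expo V. u + m \<in> A)"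

lemma ideal_polys:
  assumes "up_closed V A"
  shows "ideal (polys A :: ('v, 'k::field) mpoly set) (poly_ring V)"
proof -
  interpret cring "poly_ring V :: ('v, 'k) mpoly ring" by (rule cring_poly_ring)
  have mult: "a * p \<in> polys A" if "p \<in> polys A" "a \<in> polys (expo V)" for a p :: "('v, 'k) mpoly"
    by (rule polys_mult [OF that(2,1)]) (use assms in \<open>auto simp: up_closed_def\<close>)
  have mult': "p * a \<in> polys A" if "p \<in> polys A" "a \<in> polys (expo V)" for a p :: "('v, 'k) mpoly"
    using mult [OF that] by (simp add: mult.commute)
  show ?thesis
  proof (rule idealI)
    show "subgroup (polys A) (add_monoid (poly_ring V :: ('v, 'k) mpoly ring))"
    proof (rule add.subgroupI)
      show "polys A \<subseteq> carrier (poly_ring V :: ('v, 'k) mpoly ring)"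
        using assms by (auto simp: carrier_poly_ring polys_def up_closed_def)
      fix a :: "('v, 'k) mpoly"
      assume a: "a \<in> polys A"
      then have "a \<in> carrier (poly_ring V)"
        using assms by (auto simp: carrier_poly_ring polys_def up_closed_def)
      then have "\<ominus>\<^bsub>poly_ring V\<^esub> a = - a"
        by (intro minus_equality) (auto simp: carrier_poly_ring polys_uminus)
      then show "\<ominus>\<^bsub>poly_ring V\<^esub> a \<in> polys A" using a by (simp add: polys_uminus)
    next
      show "polys A \<noteq> ({} :: ('v, 'k) mpoly set)" using polys_0 by blast
    qed (auto simp: polys_add)
    show "ring (poly_ring V :: ('v, 'k) mpoly ring)" by (rule ring_axioms)
  qed (auto simp: carrier_poly_ring mult mult')
qed

lemma generated_self: "g \<in> G \<Longrightarrow> g \<in> {u + g | u g. g \<in> G \<and> u \<in> expo V}"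
  by (rule CollectI, intro exI [of _ 0] exI [of _ g]) simp

lemma up_closed_generated:
  "G \<subseteq> expo V \<Longrightarrow> up_closed V {u + g | u g. g \<in> G \<and> u \<in> expo V}"
  by (fastforce simp: up_closed_def add.assoc [symmetric])

text \<open>The span of the multiples of the generators is an ideal that contains them, and each of
  its terms is a scalar times a monomial times a generator.\<close>

lemma Idl_monom:
  assumes "G \<subseteq> expo V"
  shows "Idl\<^bsub>poly_ring V\<^esub> (monom ` G) =
    (polys {u + g | u g. g \<in> G \<and> u \<in> expo V} :: ('v, 'k::field) mpoly set)"
    (is "?I = polys ?A")
proof
  interpret cring "poly_ring V :: ('v, 'k) mpoly ring" by (rule cring_poly_ring)
  have carr: "monom ` G \<subseteq> carrier (poly_ring V :: ('v, 'k) mpoly ring)"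
    using assms by (auto simp: carrier_poly_ring)
  show "?I \<subseteq> polys ?A"
  proof (intro genideal_minimal ideal_polys up_closed_generated [OF assms])
    show "monom ` G \<subseteq> polys ?A"
      using generated_self by fastforce
  qed
  interpret I: ideal ?I "poly_ring V" by (rule genideal_ideal [OF carr])
  show "polys ?A \<subseteq> ?I"
  proof
    fix p :: "('v, 'k) mpoly"
    assume "p \<in> polys ?A"
    then show "p \<in> ?I"
    proof (induction p rule: polys_induct)
      case zero
      then show ?case using I.zero_closed by simp
    next
      case (monom c m)
      then obtain u g where m: "m = u + g" "g \<in> G" "u \<in> expo V" by blast
      have "const_poly c * monom u \<in> carrier (poly_ring V)"
        using m by (simp add: carrier_poly_ring polys_const_mult)
      moreover have "monom g \<in> ?I" using genideal_self [OF carr] m by blast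
      ultimately show ?case
        using I.I_l_closed by (force simp: m monom_add mult.assoc)
    next
      case (add p q)
      then show ?case using I.a_closed by simp
    qed
  qed
qed

lemma monomials_obtain:
  fixes M :: "('v, 'k::field) mpoly set"
  assumes "M \<subseteq> monomials V"
  obtains G where "M = monom ` G" "G \<subseteq> expo V"
proof
  show "M = monom ` {m \<in> expo V. monom m \<in> M}"
    using assms by (auto simp: monomials_def expo_def)
qed auto

lemma monomial_ideal_iff:
  fixes J :: "('v, 'k::field) mpoly set"
  shows "monomial_ideal V J \<longleftrightarrow> (\<exists>A. up_closed V A \<and> J = polys A)"
proof
  assume "monomial_ideal V J"
  then obtain M where M: "M \<subseteq> monomials V" "J = Idl\<^bsub>poly_ring V\<^esub> M"
    by (auto simp: monomial_ideal_def)
  obtain G where "M = monom ` G" "G \<subseteq> expo V"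
    by (rule monomials_obtain [OF M(1)])
  then show "\<exists>A. up_closed V A \<and> J = polys A"
    using M(2) Idl_monom up_closed_generated by blast
next
  assume "\<exists>A. up_closed V A \<and> J = polys A"
  then obtain A where A: "up_closed V A" "J = polys A" by blast
  \<comment> \<open>All of \<open>A\<close> serves as generating set; being closed under multiples,
    it produces nothing new.\<close>
  have "{u + g | u g. g \<in> A \<and> u \<in> expo V} = A"
  proof
    show "{u + g | u g. g \<in> A \<and> u \<in> expo V} \<subseteq> A"
      using A(1) by (auto simp: up_closed_def)
  qed (rule subsetI, rule generated_self)
  moreover have "A \<subseteq> expo V" using A(1) by (simp add: up_closed_def)
  ultimately have "J = Idl\<^bsub>poly_ring V\<^esub> (monom ` A)"
    by (subst Idl_monom) (simp_all add: A(2))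
  moreover have "monom ` A \<subseteq> monomials V"
    using \<open>A \<subseteq> expo V\<close> by (auto simp: monomials_def expo_def)
  ultimately show "monomial_ideal V J" by (auto simp: monomial_ideal_def)
qed

section \<open>Stanley-Reisner ideals as spans of monomials\<close>

definition nonface_expo :: "'v set \<Rightarrow> 'v set set \<Rightarrow> ('v \<Rightarrow>\<^sub>0 nat) set" where
  "nonface_expo V \<Delta> = {m \<in> expo V. keys m \<notin> \<Delta>}"

definition sqfree :: "'v set \<Rightarrow> 'v \<Rightarrow>\<^sub>0 nat" where
  "sqfree N = (\<Sum>v\<in>N. single v 1)"

lemma keys_sqfree: "finite N \<Longrightarrow> keys (sqfree N) = N"
  by (induction N rule: finite_induct) (auto simp: sqfree_def keys_exponent_add)

lemma lookup_sqfree: "finite N \<Longrightarrow> lookup (sqfree N) v = (if v \<in> N then 1 else 0)"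
  by (induction N rule: finite_induct) (auto simp: sqfree_def lookup_add lookup_single when_def)

lemma prod_X: "(\<Prod>v\<in>N. X v) = monom (sqfree N)"
  by (induction N rule: infinite_finite_induct) (auto simp: sqfree_def X_def monom_add)

lemma sqfree_insert: "finite N \<Longrightarrow> v \<notin> N \<Longrightarrow> sqfree (insert v N) = single v 1 + sqfree N"
  by (simp add: sqfree_def)

lemma exponent_eq_add_iff: "(\<exists>u. m = u + g) \<longleftrightarrow> (\<forall>v. lookup g v \<le> lookup (m :: 'v \<Rightarrow>\<^sub>0 nat) v)"
proof
  assume "\<forall>v. lookup g v \<le> lookup m v"
  then have "m = (m - g) + g"
    by (intro poly_mapping_eqI) (simp add: lookup_add lookup_minus)
  then show "\<exists>u. m = u + g" by blast
qed (auto simp: lookup_add)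

lemma sqfree_divides: "finite N \<Longrightarrow> N \<subseteq> keys m \<Longrightarrow> \<exists>u. m = u + sqfree N"
  unfolding exponent_eq_add_iff by (auto simp: lookup_sqfree in_keys_iff Suc_le_eq)

lemma up_closed_nonface:
  assumes "simplicial_complex V \<Delta>" shows "up_closed V (nonface_expo V \<Delta>)"
  using assms by (auto simp: up_closed_def nonface_expo_def keys_exponent_add simplicial_complex_def)

text \<open>A monomial is a multiple of the squarefree monomial on its support, and a set containing
  a nonface is a nonface. Membership in the ideal thus depends on the support alone.\<close>

lemma SR_ideal_eq:
  assumes "simplicial_complex V \<Delta>"
  shows "SR_ideal V \<Delta> = polys (nonface_expo V \<Delta>)"
proof -
  define G where "G = sqfree ` {N. N \<subseteq> V \<and> N \<notin> \<Delta>}"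
  have fin: "finite N" if "N \<subseteq> V" for N
    using assms that finite_subset by (auto simp: simplicial_complex_def)
  have G: "G \<subseteq> expo V" using fin by (auto simp: G_def expo_def keys_sqfree)
  have "SR_ideal V \<Delta> = Idl\<^bsub>poly_ring V\<^esub> (monom ` G)"
    unfolding SR_ideal_def G_def prod_X by (rule arg_cong [of _ _ "genideal _"]) auto
  also have "\<dots> = polys {u + g | u g. g \<in> G \<and> u \<in> expo V}"
    by (rule Idl_monom [OF G])
  also have "{u + g | u g. g \<in> G \<and> u \<in> expo V} = nonface_expo V \<Delta>"
  proof (intro equalityI subsetI)
    fix m assume "m \<in> {u + g | u g. g \<in> G \<and> u \<in> expo V}"
    then obtain u N where "m = u + sqfree N" "N \<subseteq> V" "N \<notin> \<Delta>" "u \<in> expo V"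
      by (auto simp: G_def)
    then show "m \<in> nonface_expo V \<Delta>"
      using assms fin unfolding nonface_expo_def simplicial_complex_def
      by (auto simp: keys_exponent_add keys_sqfree) (auto simp: expo_def keys_sqfree)
  next
    fix m assume m: "m \<in> nonface_expo V \<Delta>"
    then obtain u where u: "m = u + sqfree (keys m)"
      using sqfree_divides [of "keys m" m] by auto
    have "sqfree (keys m) \<in> G" using m by (auto simp: G_def nonface_expo_def expo_def)
    moreover have "u \<in> expo V" using m u unfolding nonface_expo_def
      by (metis (mono_tags) expo_add mem_Collect_eq)
    ultimately show "m \<in> {u + g | u g. g \<in> G \<and> u \<in> expo V}" using u by blast
  qed
  finally show ?thesis .
qed

subsection \<open>Minimal generators\<close>

definition min_expo :: "('v \<Rightarrow>\<^sub>0 nat) set \<Rightarrow> ('v \<Rightarrow>\<^sub>0 nat) \<Rightarrow> bool" where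
  "min_expo A m \<longleftrightarrow> m \<in> A \<and> (\<forall>u n. m = u + n \<longrightarrow> n \<in> A \<longrightarrow> u = 0)"

text \<open>The total degree drops strictly from a monomial to a proper divisor, which makes the
  descent in \<open>min_expo_below\<close> terminate.\<close>

lemma exponent_size_less:
  assumes "u \<noteq> (0 :: 'v \<Rightarrow>\<^sub>0 nat)"
  shows "(\<Sum>v\<in>keys n. lookup n v) < (\<Sum>v\<in>keys (u + n). lookup (u + n) v)"
proof -
  obtain v where v: "v \<in> keys u" using assms keys_eq_empty by fastforce
  have "(\<Sum>v\<in>keys n. lookup n v) = (\<Sum>v\<in>keys u \<union> keys n. lookup n v)"
    by (rule sum.mono_neutral_left) (auto simp: in_keys_iff)
  also have "\<dots> < (\<Sum>v\<in>keys u \<union> keys n. lookup (u + n) v)"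
    using v by (intro sum_strict_mono_ex1) (auto simp: lookup_add in_keys_iff)
  finally show ?thesis by (simp add: keys_exponent_add)
qed

lemma min_expo_below:
  assumes "m \<in> A" shows "\<exists>u n. m = u + n \<and> min_expo A n"
  using assms
proof (induction m rule: measure_induct_rule [of "\<lambda>m. \<Sum>v\<in>keys m. lookup m v"])
  case (less m)
  show ?case
  proof (cases "min_expo A m")
    case True
    then show ?thesis by (intro exI [of _ 0] exI [of _ m]) simp
  next
    case False
    then obtain u n where "m = u + n" "n \<in> A" "u \<noteq> 0"
      using less.prems by (auto simp: min_expo_def)
    then show ?thesis using less.IH [of n] exponent_size_less [of u n] by (metis add.assoc)
  qed
qed

lemma inj_monom: "inj (monom :: ('v \<Rightarrow>\<^sub>0 nat) \<Rightarrow> ('v, 'k::field) mpoly)"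
  by (metis injI keys_monom singleton_inject)

lemma polys_eq_iff: "polys A = (polys B :: ('v, 'k::field) mpoly set) \<longleftrightarrow> A = B"
proof
  assume eq: "polys A = (polys B :: ('v, 'k) mpoly set)"
  have "m \<in> A \<longleftrightarrow> m \<in> B" for m
  proof -
    have "(monom m :: ('v, 'k) mpoly) \<in> polys A \<longleftrightarrow> (monom m :: ('v, 'k) mpoly) \<in> polys B"
      by (simp only: eq)
    then show ?thesis by simp
  qed
  then show "A = B" by blast
qed simp

lemma minimal_monomial_generator_iff:
  fixes g :: "('v, 'k::field) mpoly"
  assumes A: "up_closed V A"
  shows "minimal_monomial_generator V (polys A) g \<longleftrightarrow> (\<exists>m. min_expo A m \<and> g = monom m)"
proof
  assume "minimal_monomial_generator V (polys A) g"
  then obtain M where M: "M \<subseteq> monomials V" "polys A = Idl\<^bsub>poly_ring V\<^esub> M" "g \<in> M"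
    and min: "\<And>N. N \<subset> M \<Longrightarrow> polys A \<noteq> Idl\<^bsub>poly_ring V\<^esub> N"
    by (auto simp: minimal_monomial_generator_def)
  obtain G where G: "M = monom ` G" "G \<subseteq> expo V" by (rule monomials_obtain [OF M(1)])
  obtain m where m: "m \<in> G" "g = monom m" using M(3) G(1) by blast
  have A_eq: "A = {u + g | u g. g \<in> G \<and> u \<in> expo V}"
    using M(2) unfolding G(1) Idl_monom [OF G(2)] polys_eq_iff .
  have "m \<in> A" using m(1) unfolding A_eq by (rule generated_self)
  moreover have "u = 0" if mn: "m = u + n" "n \<in> A" for u n
  proof (rule ccontr)
    assume "u \<noteq> 0"
    obtain w h where h: "n = w + h" "h \<in> G" "w \<in> expo V" using mn(2) A_eq by blast
    have "h \<noteq> m"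
    proof
      assume "h = m"
      then have "u + w = 0" using mn(1) h(1) by (simp add: add.assoc [symmetric])
      then have "keys u \<union> keys w = {}" by (simp add: keys_exponent_add [symmetric])
      then show False using \<open>u \<noteq> 0\<close> by simp
    qed
    have uw: "u + w \<in> expo V" "m = (u + w) + h"
      using mn(1) h m(1) G(2) by (auto simp: add.assoc)
    define N where "N = (monom ` (G - {m}) :: ('v, 'k) mpoly set)"
    have "N = M - {g}"
      unfolding N_def G(1) m(2) by (simp add: image_set_diff [OF inj_monom])
    then have "N \<subset> M" using M(3) by blast
    moreover have "A = {u + g | u g. g \<in> G - {m} \<and> u \<in> expo V}"
    proof
      show "A \<subseteq> {u + g | u g. g \<in> G - {m} \<and> u \<in> expo V}"
      proof
        fix a assume "a \<in> A"
        then obtain b c where bc: "a = b + c" "c \<in> G" "b \<in> expo V" using A_eq by blast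
        show "a \<in> {u + g | u g. g \<in> G - {m} \<and> u \<in> expo V}"
        proof (cases "c = m")
          case True
          then have "a = (b + (u + w)) + h" using bc(1) uw(2) by (simp add: add.assoc)
          moreover have "b + (u + w) \<in> expo V" using bc uw by simp
          ultimately show ?thesis using h(2) \<open>h \<noteq> m\<close> by blast
        qed (use bc in blast)
      qed
    qed (use A_eq in blast)
    then have "polys A = Idl\<^bsub>poly_ring V\<^esub> N"
      unfolding N_def using G(2) by (subst Idl_monom) auto
    ultimately show False using min by blast
  qed
  ultimately show "\<exists>m. min_expo A m \<and> g = monom m" using m(2) by (auto simp: min_expo_def)
next
  assume "\<exists>m. min_expo A m \<and> g = monom m"
  then obtain m where m: "min_expo A m" "g = monom m" by blast
  define G where "G = {m. min_expo A m}"
  have AV: "A \<subseteq> expo V" using A by (simp add: up_closed_def)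
  then have GV: "G \<subseteq> expo V" by (auto simp: G_def min_expo_def)
  have "A = {u + g | u g. g \<in> G \<and> u \<in> expo V}"
  proof
    show "A \<subseteq> {u + g | u g. g \<in> G \<and> u \<in> expo V}"
    proof
      fix a assume "a \<in> A"
      then obtain u n where "a = u + n" "min_expo A n" using min_expo_below by blast
      moreover have "u \<in> expo V" using \<open>a \<in> A\<close> AV \<open>a = u + n\<close> by auto
      ultimately show "a \<in> {u + g | u g. g \<in> G \<and> u \<in> expo V}" by (auto simp: G_def)
    qed
    show "{u + g | u g. g \<in> G \<and> u \<in> expo V} \<subseteq> A"
      using A by (auto simp: up_closed_def G_def min_expo_def)
  qed
  then have "polys A = Idl\<^bsub>poly_ring V\<^esub> (monom ` G :: ('v, 'k) mpoly set)"
    by (subst Idl_monom [OF GV]) simp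
  moreover have "monom ` G \<subseteq> (monomials V :: ('v, 'k) mpoly set)"
    using GV by (auto simp: monomials_def expo_def)
  moreover have "polys A \<noteq> Idl\<^bsub>poly_ring V\<^esub> N"
    if N: "N \<subset> (monom ` G :: ('v, 'k) mpoly set)" for N
  proof
    assume eq: "polys A = Idl\<^bsub>poly_ring V\<^esub> N"
    obtain H where "H \<subseteq> G" and H: "N = monom ` H"
      using N subset_imageE [of N monom G] by blast
    then have H: "H \<subset> G" "N = monom ` H" using N by auto
    then have HV: "H \<subseteq> expo V" using GV by blast
    \<comment> \<open>The dropped exponent \<open>h\<close> would have to be a multiple of a
      remaining one, hence equal to it.\<close>
    obtain h where h: "h \<in> G" "h \<notin> H" using H(1) by blast
    have "A = {u + g | u g. g \<in> H \<and> u \<in> expo V}"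
      using eq unfolding H(2) Idl_monom [OF HV] polys_eq_iff .
    then obtain u g where "h = u + g" "g \<in> H"
      using h(1) by (auto simp: G_def min_expo_def)
    moreover have "g \<in> A" using \<open>g \<in> H\<close> H(1) by (auto simp: G_def min_expo_def)
    ultimately have "u = 0" using h(1) by (auto simp: G_def min_expo_def)
    then show False using \<open>h = u + g\<close> \<open>g \<in> H\<close> h(2) by simp
  qed
  moreover have "g \<in> monom ` G" using m by (simp add: G_def)
  ultimately show "minimal_monomial_generator V (polys A) g"
    unfolding minimal_monomial_generator_def by blast
qed

lemma keys_add_single: "v \<in> keys m \<Longrightarrow> \<exists>u. m = single v 1 + (u :: 'v \<Rightarrow>\<^sub>0 nat)"
  using exponent_eq_add_iff [of m "single v 1"]
  by (force simp: lookup_single when_def in_keys_iff add.commute)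

lemma X_divides_monom_iff:
  assumes "m \<in> expo V"
  shows "X v divides\<^bsub>poly_ring V\<^esub> (monom m :: ('v, 'k::field) mpoly) \<longleftrightarrow> v \<in> keys m"
proof
  assume "X v divides\<^bsub>poly_ring V\<^esub> (monom m :: ('v, 'k) mpoly)"
  then obtain c :: "('v, 'k) mpoly" where "monom m = X v * c" by (auto simp: factor_def)
  then have "{m} = (+) (single v 1) ` keys c"
    using keys_monom_mult [of "single v 1" c] keys_monom by (metis X_def)
  then obtain u where "m = single v 1 + u" by blast
  then show "v \<in> keys m" by (simp add: keys_exponent_add)
next
  assume "v \<in> keys m"
  then obtain u where u: "m = single v 1 + u" using keys_add_single [of v m] by auto
  then have "u \<in> expo V" using assms by simp
  then show "X v divides\<^bsub>poly_ring V\<^esub> (monom m :: ('v, 'k) mpoly)"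
    unfolding factor_def by (intro bexI [of _ "monom u"]) (simp_all add: u monom_add X_def carrier_poly_ring)
qed

subsection \<open>Separations\<close>

text \<open>The exponent of the image of a monomial when each variable \<open>v\<close> is replaced
  by \<open>f v\<close>; exponents add up where \<open>f\<close> identifies variables. In the case
  of \<open>push i\<close> this is the specialization of \<open>y\<close> to
  \<open>x_i\<close>.\<close>

definition rename :: "('v \<Rightarrow> 'w) \<Rightarrow> ('v \<Rightarrow>\<^sub>0 nat) \<Rightarrow> 'w \<Rightarrow>\<^sub>0 nat" where
  "rename f m = (\<Sum>v\<in>keys m. single (f v) (lookup m v))"

abbreviation push :: "'v \<Rightarrow> ('v option \<Rightarrow>\<^sub>0 nat) \<Rightarrow> 'v \<Rightarrow>\<^sub>0 nat" where
  "push i \<equiv> rename (case_option i id)"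

lemma keys_exponent_sum:
  "finite B \<Longrightarrow> keys (\<Sum>v\<in>B. f v :: 'v \<Rightarrow>\<^sub>0 nat) = (\<Union>v\<in>B. keys (f v))"
  by (induction B rule: finite_induct) (auto simp: keys_exponent_add)

lemma keys_rename: "keys (rename f m) = f ` keys m"
  by (auto simp: rename_def keys_exponent_sum in_keys_iff)

lemma lookup_push: "lookup (push i m) v = lookup m (Some v) + (if v = i then lookup m None else 0)"
proof -
  let ?h = "\<lambda>w. if case_option i id w = v then lookup m w else 0"
  have "lookup (push i m) v = (\<Sum>w\<in>keys m. ?h w)"
    by (simp add: rename_def lookup_sum lookup_single when_def)
  also have "\<dots> = (\<Sum>w\<in>keys m \<union> {None, Some v}. ?h w)"
    by (rule sum.mono_neutral_left) (auto simp: in_keys_iff)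
  also have "\<dots> = (\<Sum>w\<in>{None, Some v}. ?h w)"
    by (rule sum.mono_neutral_right) (auto simp: in_keys_iff split: option.splits)
  finally show ?thesis by simp
qed

lemma push_add: "push i (m + n) = push i m + push i n"
  by (rule poly_mapping_eqI) (simp add: lookup_push lookup_add)

lemma push_0 [simp]: "push i 0 = 0"
  by (rule poly_mapping_eqI) (simp add: lookup_push)

lemma push_single: "push i (single w k) = single (case_option i id w) k"
  by (rule poly_mapping_eqI) (auto simp: lookup_push lookup_single when_def split: option.splits)

text \<open>Any choice of variables lying over the given ones yields a preimage under
  \<open>push i\<close>; the construction of a separation lifts exponents in this way.\<close>

lemma push_rename:
  assumes "\<And>v. v \<in> keys m \<Longrightarrow> case_option i id (f v) = v"
  shows "push i (rename f m) = m"
proof -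
  have "push i (\<Sum>v\<in>B. single (f v) (lookup m v)) = (\<Sum>v\<in>B. single v (lookup m v))"
    if "B \<subseteq> keys m" for B
    using finite_subset [OF that finite_keys] that
    by (induction B) (auto simp: push_add push_single assms)
  then have "push i (rename f m) = (\<Sum>v\<in>keys m. single v (lookup m v))"
    unfolding rename_def [of f] by blast
  also have "\<dots> = m"
    by (rule poly_mapping_eqI) (auto simp: lookup_sum lookup_single when_def in_keys_iff)
  finally show ?thesis .
qed

lemma X_power: "X v ^ k = monom (single v k)"
  by (induction k) (auto simp: X_def monom_add [symmetric] single_add [symmetric])

lemma prod_monom: "(\<Prod>v\<in>B. monom (f v)) = monom (\<Sum>v\<in>B. f v)"
  by (induction B rule: infinite_finite_induct) (auto simp: monom_add)

lemma alg_hom_push: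
  fixes p :: "('v option, 'k::field) mpoly"
  shows "alg_hom (case_option (X i) X) p = lin (\<lambda>m. monom (push i m)) p"
proof -
  have "case_option (X i) X v = (X (case_option i id v) :: ('v, 'k) mpoly)" for v
    by (simp split: option.split)
  then show ?thesis by (simp add: alg_hom_def lin_def rename_def X_power prod_monom)
qed

text \<open>Every class has a representative, so regularity in the quotient becomes a statement
  about products in the polynomial ring itself.\<close>

lemma coset_mult_eq_zero_iff:
  assumes "ideal J (poly_ring V)" "a \<in> carrier (poly_ring V)"
  shows "(\<forall>q\<in>carrier (poly_ring V Quot J). (J +>\<^bsub>poly_ring V\<^esub> a) \<otimes>\<^bsub>poly_ring V Quot J\<^esub> q
             = \<zero>\<^bsub>poly_ring V Quot J\<^esub> \<longrightarrow> q = \<zero>\<^bsub>poly_ring V Quot J\<^esub>) \<longleftrightarrow>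
         (\<forall>f\<in>carrier (poly_ring V). a * f \<in> J \<longrightarrow> f \<in> J)"
proof -
  interpret ideal J "poly_ring V" by fact
  have zero: "J +>\<^bsub>poly_ring V\<^esub> f = J \<longleftrightarrow> f \<in> J" if "f \<in> carrier (poly_ring V)" for f
    using that a_coset_join1 a_coset_join2 a_subgroup by metis
  have carr: "carrier (poly_ring V Quot J) = (\<lambda>f. J +>\<^bsub>poly_ring V\<^esub> f) ` carrier (poly_ring V)"
    by (auto simp: FactRing_def A_RCOSETS_defs a_r_coset_def)
  have "(J +>\<^bsub>poly_ring V\<^esub> a) \<otimes>\<^bsub>poly_ring V Quot J\<^esub> (J +>\<^bsub>poly_ring V\<^esub> f)
      = J +>\<^bsub>poly_ring V\<^esub> (a * f)" if "f \<in> carrier (poly_ring V)" for f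
    using rcoset_mult_add [OF assms(2) that] by (simp add: FactRing_def)
  moreover have "a * f \<in> carrier (poly_ring V)" if "f \<in> carrier (poly_ring V)" for f
    using m_closed [OF assms(2) that] by simp
  ultimately show ?thesis
    unfolding carr by (simp add: zero FactRing_def)
qed

text \<open>All conditions but one turn into conditions on exponents. Regularity stays with
  polynomials, since \<open>y - x_i\<close> is not a monomial.\<close>

lemma is_separation_iff:
  fixes B :: "('v \<Rightarrow>\<^sub>0 nat) set"
  assumes "up_closed (ext_vars V) A" "i \<in> V"
  shows "is_separation V (polys B :: ('v, 'k::field) mpoly set) i (polys A) \<longleftrightarrow>
    push i ` A = B \<and>
    (\<exists>m. min_expo A m \<and> Some i \<in> keys m) \<and> (\<exists>m. min_expo A m \<and> None \<in> keys m) \<and>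
    (\<forall>f\<in>polys (expo (ext_vars V)) :: ('v option, 'k) mpoly set.
       (X None - X (Some i)) * f \<in> polys A \<longrightarrow> f \<in> polys A)"
proof -
  have i: "(X (Some i) :: ('v option, 'k) mpoly) \<in> carrier (poly_ring (ext_vars V))"
    and y: "(X None :: ('v option, 'k) mpoly) \<in> carrier (poly_ring (ext_vars V))"
    using assms(2) by (auto simp: carrier_poly_ring ext_vars_def)
  have divides: "X w divides\<^bsub>poly_ring (ext_vars V)\<^esub> (monom m :: ('v option, 'k) mpoly) \<longleftrightarrow> w \<in> keys m"
    if "m \<in> A" for m w
    using assms(1) that by (intro X_divides_monom_iff) (auto simp: up_closed_def)
  have min_expo_in: "m \<in> A" if "min_expo A m" for m using that by (simp add: min_expo_def)
  \<comment> \<open>The substitution sends monomials to monomials, so the image of a span is the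
    span of the image exponents; elements are lifted term by term.\<close>
  have "alg_hom (case_option (X i) X) ` (polys A :: ('v option, 'k) mpoly set) = polys (push i ` A)"
  proof (intro equalityI subsetI)
    fix p :: "('v, 'k) mpoly"
    assume "p \<in> polys (push i ` A)"
    then show "p \<in> alg_hom (case_option (X i) X) ` polys A"
    proof (induction p rule: polys_induct)
      case zero
      show ?case by (rule image_eqI [of _ _ 0]) (auto simp: alg_hom_push)
    next
      case (monom c m)
      then obtain a where "m = push i a" "a \<in> A" by blast
      then show ?case
        by (intro image_eqI [of _ _ "const_poly c * monom a"])
          (auto simp: alg_hom_push lin_const_mult polys_const_mult)
    next
      case (add p q)
      then obtain p' q' where "p = alg_hom (case_option (X i) X) p'" "p' \<in> polys A"
        "q = alg_hom (case_option (X i) X) q'" "q' \<in> polys A" by blast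
      then show ?case
        by (intro image_eqI [of _ _ "p' + q'"]) (auto simp: alg_hom_push lin_add polys_add)
    qed
  qed (auto simp: alg_hom_push intro!: lin_in_polys)
  then have "polys B = alg_hom (case_option (X i) X) ` (polys A :: ('v option, 'k) mpoly set)
      \<longleftrightarrow> push i ` A = B"
    by (metis polys_eq_iff)
  moreover have "(\<exists>g :: ('v option, 'k) mpoly. minimal_monomial_generator (ext_vars V) (polys A) g \<and>
      X w divides\<^bsub>poly_ring (ext_vars V)\<^esub> g) \<longleftrightarrow> (\<exists>m. min_expo A m \<and> w \<in> keys m)" for w
    by (auto simp: minimal_monomial_generator_iff [OF assms(1)] divides min_expo_in)
  moreover have "monomial_ideal (ext_vars V) (polys A :: ('v option, 'k) mpoly set)"
    using assms(1) monomial_ideal_iff by blast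
  moreover have "X None - X (Some i) \<in> carrier (poly_ring (ext_vars V) :: ('v option, 'k) mpoly ring)"
    using i y by (simp add: carrier_poly_ring polys_diff)
  note coset_mult_eq_zero_iff [OF ideal_polys [OF assms(1)] this]
  ultimately show ?thesis
    unfolding is_separation_def Let_def by (simp add: carrier_poly_ring)
qed

section \<open>Unions of two simplices have no separation\<close>

lemma nonface_simplices:
  assumes "V\<^sub>1 \<inter> V\<^sub>2 = {}"
  shows "m \<in> nonface_expo (V\<^sub>1 \<union> V\<^sub>2) (Pow V\<^sub>1 \<union> Pow V\<^sub>2) \<longleftrightarrow>
    m \<in> expo (V\<^sub>1 \<union> V\<^sub>2) \<and> keys m \<inter> V\<^sub>1 \<noteq> {} \<and> keys m \<inter> V\<^sub>2 \<noteq> {}"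
  using assms by (auto simp: nonface_expo_def expo_def)

lemma up_closed_sqfree:
  assumes "up_closed V A" "sqfree N \<in> A" "finite N" "N \<subseteq> keys m" "m \<in> expo V"
  shows "m \<in> A"
  using sqfree_divides [OF assms(3,4)] assms by (auto simp: up_closed_def)

lemma no_separation_of_simplices:
  fixes V\<^sub>1 V\<^sub>2 :: "'v set"
  assumes disj: "V\<^sub>1 \<inter> V\<^sub>2 = {}" and i: "i \<in> V\<^sub>1"
  shows "\<not> is_separation (V\<^sub>1 \<union> V\<^sub>2)
    (polys (nonface_expo (V\<^sub>1 \<union> V\<^sub>2) (Pow V\<^sub>1 \<union> Pow V\<^sub>2)) :: ('v, 'k::field) mpoly set) i J"
proof
  define V where "V = V\<^sub>1 \<union> V\<^sub>2"
  define E where "E = ext_vars V"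
  define B where "B = nonface_expo V (Pow V\<^sub>1 \<union> Pow V\<^sub>2)"
  assume "is_separation (V\<^sub>1 \<union> V\<^sub>2)
    (polys (nonface_expo (V\<^sub>1 \<union> V\<^sub>2) (Pow V\<^sub>1 \<union> Pow V\<^sub>2)) :: ('v, 'k) mpoly set) i J"
  then have sep: "is_separation V (polys B :: ('v, 'k) mpoly set) i J" by (simp add: V_def B_def)
  then have "monomial_ideal E J" by (simp add: is_separation_def E_def Let_def)
  then obtain A where A: "up_closed E A" "J = polys A" by (auto simp: monomial_ideal_iff)
  have "i \<in> V" using i by (simp add: V_def)
  note sep' = sep [unfolded A(2) is_separation_iff [OF A(1) [unfolded E_def] this]]
  have AE: "A \<subseteq> expo E" using A(1) by (simp add: up_closed_def)
  have B_iff: "m \<in> B \<longleftrightarrow> m \<in> expo V \<and> keys m \<inter> V\<^sub>1 \<noteq> {} \<and> keys m \<inter> V\<^sub>2 \<noteq> {}" for m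
    unfolding B_def V_def by (rule nonface_simplices [OF disj])
  have push_A: "push i a \<in> B" if "a \<in> A" for a using sep' that by blast
  have lift: "\<exists>a\<in>A. push i a = m" if "m \<in> B" for m using sep' that by blast
  \<comment> \<open>Regularity for a single monomial \<open>u\<close>: both terms of
    \<open>(y - x_i) u\<close> lie in \<open>J\<close>.\<close>
  have nzd: "u \<in> A" if "u \<in> expo E" "single None 1 + u \<in> A" "single (Some i) 1 + u \<in> A" for u
  proof -
    have "(X None - X (Some i)) * monom u \<in> (polys A :: ('v option, 'k) mpoly set)"
      using that by (simp add: left_diff_distrib X_def monom_add [symmetric] polys_diff)
    then show ?thesis using sep' that(1) by (auto simp: E_def)
  qed
  \<comment> \<open>A product without \<open>x_i\<close> has only one preimage under
    \<open>push i\<close>.\<close>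
  have pairs: "sqfree {Some p, Some q} \<in> A" if "p \<in> V\<^sub>1" "p \<noteq> i" "q \<in> V\<^sub>2" for p q
  proof -
    have "sqfree {p, q} \<in> B" using that by (auto simp: B_iff keys_sqfree expo_def V_def)
    then obtain a where a: "a \<in> A" "push i a = sqfree {p, q}" using lift by blast
    have "a = sqfree {Some p, Some q}"
    proof (rule poly_mapping_eqI)
      fix w
      have "lookup (push i a) v = lookup (sqfree {p, q}) v" for v using a(2) by simp
      note this [of i] this [of "the w"]
      then show "lookup a w = lookup (sqfree {Some p, Some q}) w"
        using that disj i by (cases w) (auto simp: lookup_push lookup_sqfree split: if_splits)
    qed
    then show ?thesis using a(1) by simp
  qed
  \<comment> \<open>The exponent 1 of \<open>x_i\<close> splits between \<open>y\<close> and
    \<open>x_i\<close> as 1 + 0 or as 0 + 1.\<close>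
  have pairs_i: "sqfree {None, Some q} \<in> A \<or> sqfree {Some i, Some q} \<in> A" if "q \<in> V\<^sub>2" for q
  proof -
    have "i \<noteq> q" using that i disj by blast
    have "sqfree {i, q} \<in> B" using that i by (auto simp: B_iff keys_sqfree expo_def V_def)
    then obtain a where a: "a \<in> A" "push i a = sqfree {i, q}" using lift by blast
    have "lookup (push i a) i = 1" using a(2) by (simp add: lookup_sqfree)
    then consider "lookup a None = 1" "lookup a (Some i) = 0" | "lookup a None = 0" "lookup a (Some i) = 1"
      by (fastforce simp: lookup_push add_is_1)
    then have "a = sqfree {None, Some q} \<or> a = sqfree {Some i, Some q}"
    proof cases
      case 1
      have "a = sqfree {None, Some q}"
      proof (rule poly_mapping_eqI)
        fix w
        have "lookup (push i a) (the w) = lookup (sqfree {i, q}) (the w)" using a(2) by simp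
        then show "lookup a w = lookup (sqfree {None, Some q}) w"
          using 1 \<open>i \<noteq> q\<close> by (cases w) (auto simp: lookup_push lookup_sqfree split: if_splits)
      qed
      then show ?thesis ..
    next
      case 2
      have "a = sqfree {Some i, Some q}"
      proof (rule poly_mapping_eqI)
        fix w
        have "lookup (push i a) (the w) = lookup (sqfree {i, q}) (the w)" using a(2) by simp
        then show "lookup a w = lookup (sqfree {Some i, Some q}) w"
          using 2 \<open>i \<noteq> q\<close> by (cases w) (auto simp: lookup_push lookup_sqfree split: if_splits)
      qed
      then show ?thesis ..
    qed
    then show ?thesis using a(1) by auto
  qed
  \<comment> \<open>Otherwise \<open>y x_q\<close> and \<open>x_i x_q'\<close> lie in
    \<open>J\<close> for some \<open>q\<close> and \<open>q'\<close>. Regularity then puts a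
    monomial in the variables \<open>x_q\<close> and \<open>x_q'\<close> into \<open>J\<close>,
    although its image is supported on a face of the second simplex.\<close>
  have "(\<forall>q\<in>V\<^sub>2. sqfree {None, Some q} \<in> A) \<or> (\<forall>q\<in>V\<^sub>2. sqfree {Some i, Some q} \<in> A)"
  proof (rule ccontr)
    assume "\<not> ?thesis"
    then obtain q q' where q: "q \<in> V\<^sub>2" "sqfree {None, Some q} \<in> A"
      "q' \<in> V\<^sub>2" "sqfree {Some i, Some q'} \<in> A"
      using pairs_i by blast
    define u where "u = sqfree {Some q, Some q'}"
    have keys_u: "keys u = {Some q, Some q'}" by (simp add: u_def keys_sqfree)
    have uE: "u \<in> expo E" using q by (auto simp: expo_def keys_u E_def ext_vars_def V_def)
    moreover have "single None 1 + u \<in> A"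
      by (rule up_closed_sqfree [OF A(1) q(2)])
        (use uE in \<open>auto simp: keys_exponent_add keys_u E_def ext_vars_def\<close>)
    moreover have "single (Some i) 1 + u \<in> A"
      by (rule up_closed_sqfree [OF A(1) q(4)])
        (use uE \<open>i \<in> V\<close> in \<open>auto simp: keys_exponent_add keys_u E_def ext_vars_def\<close>)
    ultimately have "push i u \<in> B" using nzd push_A by blast
    then show False using q disj by (auto simp: B_iff keys_rename keys_u)
  qed
  \<comment> \<open>Naming the two variables \<open>z\<close> and \<open>w\<close> treats both
    alternatives at once.\<close>
  then obtain z w where zw: "{z, w} = {None, Some i}" "z \<noteq> w" and z: "\<forall>q\<in>V\<^sub>2. sqfree {z, Some q} \<in> A"
    by fastforce
  have zE: "z \<in> E" "w \<in> E" using zw \<open>i \<in> V\<close> by (auto simp: E_def ext_vars_def doubleton_eq_iff)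
  have push_zw: "push i (single z 1) = push i (single w 1)"
    using zw by (auto simp: push_single doubleton_eq_iff)
  have "w = None \<or> w = Some i" using zw(1) by blast
  then obtain g where g: "min_expo A g" "w \<in> keys g" using sep' by blast
  obtain u where u: "g = single w 1 + u" using keys_add_single [OF g(2)] by auto
  have uE: "u \<in> expo E" using AE g(1) u by (auto simp: min_expo_def)
  have "u \<notin> A"
  proof
    assume "u \<in> A"
    then have "single w (1::nat) = 0" using g(1) u unfolding min_expo_def by blast
    then show False by (metis keys_single keys_zero insert_not_empty one_neq_zero)
  qed
  moreover have "g \<in> A" using g(1) by (simp add: min_expo_def)
  \<comment> \<open>By minimality \<open>u = g / w\<close> is not in \<open>A\<close>, while
    \<open>w u = g\<close> is; regularity therefore excludes \<open>z u\<close>.\<close>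
  ultimately have zu: "single z 1 + u \<notin> A"
    using nzd [OF uE] zw u by (auto simp: doubleton_eq_iff)
  \<comment> \<open>Specialization does not distinguish \<open>z\<close> from \<open>w\<close>, so
    the image of \<open>z u\<close> is that of \<open>g\<close> and contains some \<open>p\<close>
    and \<open>q\<close>. As \<open>z x_q\<close> and, for \<open>p\<close> different from
    \<open>i\<close>, \<open>x_p x_q\<close> have exponents in \<open>A\<close>, so does
    \<open>z u\<close>: a contradiction.\<close>
  have "push i (single z 1 + u) = push i g"
    by (simp only: push_add push_zw u)
  then have "push i (single z 1 + u) \<in> B" using push_A \<open>g \<in> A\<close> by simp
  then obtain p q where pq: "p \<in> V\<^sub>1" "q \<in> V\<^sub>2"
    "p \<in> case_option i id ` keys (single z 1 + u)" "q \<in> case_option i id ` keys (single z 1 + u)"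
    by (auto simp: B_iff keys_rename)
  have "single z 1 + u \<in> expo E" using uE zE by simp
  note up = up_closed_sqfree [OF A(1) _ _ _ this]
  have qk: "Some q \<in> keys (single z 1 + u)"
    using pq(2,4) i disj by (auto split: option.splits)
  have zk: "z \<in> keys (single z 1 + u)" by (simp add: keys_exponent_add)
  show False
  proof (cases "p = i")
    case True
    have "sqfree {z, Some q} \<in> A" using z pq(2) by blast
    then show False using up qk zk zu by simp
  next
    case False
    then have "Some p \<in> keys (single z 1 + u)" using pq(3) by (auto split: option.splits)
    then show False using up pairs [OF pq(1) False pq(2)] qk zu by simp
  qed
qed

section \<open>Regularity of a difference of variables, and minimal nonfaces\<close>

text \<open>
  If \<open>m\<close> is a monomial of \<open>f\<close> with \<open>z m\<close> outside the ideal, the vanishing of the coefficient of \<open>z m\<close>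
  makes \<open>z m / w\<close> a monomial of \<open>f\<close> as well; its exponent of \<open>w\<close> is smaller, so this descends forever.
\<close>

lemma nonzerodivisor_difference:
  fixes f :: "('v, 'k::field) mpoly"
  assumes sc: "simplicial_complex E \<Gamma>" and xy: "x \<in> E" "y \<in> E" "x \<noteq> y"
    and ext: "\<And>F. F \<in> \<Gamma> \<Longrightarrow> insert x F \<in> \<Gamma> \<or> insert y F \<in> \<Gamma>"
    and f: "f \<in> polys (expo E)" "(X y - X x) * f \<in> polys (nonface_expo E \<Gamma>)"
  shows "f \<in> polys (nonface_expo E \<Gamma>)"
proof -
  have no_key: False
    if "m \<in> keys f" "insert z (keys m) \<in> \<Gamma>" "z \<in> E" "z \<noteq> w"
      "(X z - X w) * f \<in> polys (nonface_expo E \<Gamma>)" for m z w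
    using that
  proof (induction "lookup m w" arbitrary: m rule: less_induct)
    case less
    have "single z 1 + m \<notin> nonface_expo E \<Gamma>"
      using less.prems(2) by (simp add: nonface_expo_def keys_exponent_add)
    then have "lookup ((X z - X w) * f) (single z 1 + m) = 0"
      using less.prems(5) by (auto simp: polys_def in_keys_iff)
    then have "lookup (X w * f) (single z 1 + m) = lookup f m"
      by (simp add: left_diff_distrib lookup_minus X_def)
    then have "single z 1 + m \<in> keys (X w * f)"
      using less.prems(1) by (simp add: in_keys_iff)
    then obtain m' where m': "m' \<in> keys f" "single z 1 + m = single w 1 + m'"
      by (auto simp: X_def keys_monom_mult)
    have "lookup (single z 1 + m) w = lookup (single w 1 + m') w" by (simp only: m'(2))
    then have "lookup m' w < lookup m w"
      using less.prems(4) by (simp add: lookup_add lookup_single)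
    moreover have "keys (single z 1 + m) = keys (single w 1 + m')" by (simp only: m'(2))
    \<comment> \<open>Passing from \<open>m\<close> to \<open>m' = z m / w\<close> adds at most
      \<open>z\<close> to the support, so the face hypothesis survives the descent.\<close>
    then have "insert z (keys m') \<subseteq> insert z (keys m)" by (auto simp: keys_exponent_add)
    then have "insert z (keys m') \<in> \<Gamma>"
      using less.prems(2) sc unfolding simplicial_complex_def by blast
    ultimately show False using less.hyps m'(1) less.prems by blast
  qed
  \<comment> \<open>The face \<open>keys m\<close> may extend by \<open>x\<close> or by
    \<open>y\<close>; changing the sign lets the descent run in either direction.\<close>
  have "(X x - X y) * f \<in> polys (nonface_expo E \<Gamma>)"
    using polys_uminus [OF f(2)] by (simp add: left_diff_distrib)
  then have "keys m \<notin> \<Gamma>" if "m \<in> keys f" for m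
    using that ext [of "keys m"] no_key [of m x y] no_key [of m y x] xy f(2) by blast
  then show ?thesis using f(1) by (auto simp: polys_def nonface_expo_def)
qed

text \<open>The support of a proper divisor of the squarefree monomial on \<open>N\<close> misses
  some \<open>v\<close> in \<open>N\<close>, so it lies in the face \<open>N - {v}\<close>.\<close>

lemma min_expo_sqfree:
  assumes sc: "simplicial_complex E \<Gamma>"
    and N: "N \<subseteq> E" "N \<notin> \<Gamma>" "\<And>v. v \<in> N \<Longrightarrow> N - {v} \<in> \<Gamma>"
  shows "min_expo (nonface_expo E \<Gamma>) (sqfree N)"
proof -
  have "finite N" using sc N(1) finite_subset unfolding simplicial_complex_def by blast
  note keys = keys_sqfree [OF this] and lookup = lookup_sqfree [OF this]
  have "u = 0" if un: "sqfree N = u + n" "n \<in> nonface_expo E \<Gamma>" for u n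
  proof (rule ccontr)
    assume "u \<noteq> 0"
    then obtain v where v: "v \<in> keys u" by fastforce
    have *: "lookup (sqfree N) w = lookup u w + lookup n w" for w by (simp add: un(1) lookup_add)
    have "v \<in> N" "v \<notin> keys n"
      using * [of v] v by (auto simp: lookup in_keys_iff split: if_splits)
    moreover have "keys n \<subseteq> N"
      using un(1) keys keys_exponent_add [of u n] by auto
    ultimately have "keys n \<subseteq> N - {v}" by blast
    then show False
      using N(3) [OF \<open>v \<in> N\<close>] un(2) sc
      unfolding simplicial_complex_def nonface_expo_def by blast
  qed
  then show ?thesis using N by (simp add: min_expo_def nonface_expo_def expo_def keys)
qed

lemma minimal_nonface:
  assumes sc: "simplicial_complex W \<Gamma>" and "\<Gamma> \<noteq> Pow W"
  obtains N where "N \<subseteq> W" "N \<notin> \<Gamma>" "\<And>v. v \<in> N \<Longrightarrow> N - {v} \<in> \<Gamma>"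
proof -
  have "finite W" using sc by (simp add: simplicial_complex_def)
  obtain M where "M \<subseteq> W" "M \<notin> \<Gamma>"
    using assms by (auto simp: simplicial_complex_def)
  then have "\<exists>N. N \<subseteq> W \<and> N \<notin> \<Gamma> \<and> (\<forall>v\<in>N. N - {v} \<in> \<Gamma>)"
  proof (induction "card M" arbitrary: M rule: less_induct)
    case less
    show ?case
    proof (cases "\<forall>v\<in>M. M - {v} \<in> \<Gamma>")
      case False
      then obtain v where v: "v \<in> M" "M - {v} \<notin> \<Gamma>" by blast
      have "card (M - {v}) < card M"
        using v(1) less.prems(1) \<open>finite W\<close> by (meson card_Diff1_less finite_subset)
      then show ?thesis using less.hyps [of "M - {v}"] v less.prems by blast
    qed (use less.prems in blast)
  qed
  then show ?thesis using that by blast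
qed

subsection \<open>Separations of disjoint unions\<close>

locale disjoint_complexes =
  fixes V\<^sub>1 V\<^sub>2 :: "'v set" and \<Delta>\<^sub>1 \<Delta>\<^sub>2 :: "'v set set"
  assumes sc1: "simplicial_complex V\<^sub>1 \<Delta>\<^sub>1" and sc2: "simplicial_complex V\<^sub>2 \<Delta>\<^sub>2"
    and nontrivial1: "\<Delta>\<^sub>1 \<noteq> {{}}" and nontrivial2: "\<Delta>\<^sub>2 \<noteq> {{}}"
    and disj: "V\<^sub>1 \<inter> V\<^sub>2 = {}"
    and vertices1: "\<forall>j\<in>V\<^sub>1. {j} \<in> \<Delta>\<^sub>1" and vertices2: "\<forall>j\<in>V\<^sub>2. {j} \<in> \<Delta>\<^sub>2"
begin

abbreviation "V \<equiv> V\<^sub>1 \<union> V\<^sub>2"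
abbreviation "\<Delta> \<equiv> \<Delta>\<^sub>1 \<union> \<Delta>\<^sub>2"

text \<open>The hypotheses are symmetric, so results on the first complex carry over to the second
  by exchanging their roles.\<close>

lemma commute: "disjoint_complexes V\<^sub>2 V\<^sub>1 \<Delta>\<^sub>2 \<Delta>\<^sub>1"
  using disjoint_complexes_axioms unfolding disjoint_complexes_def by blast

lemma finite_V1: "finite V\<^sub>1" and finite_V2: "finite V\<^sub>2"
  and empty_face: "{} \<in> \<Delta>\<^sub>1" "{} \<in> \<Delta>\<^sub>2"
  using sc1 sc2 by (simp_all add: simplicial_complex_def)

lemma faces: "F \<in> \<Delta>\<^sub>1 \<Longrightarrow> F \<subseteq> V\<^sub>1" "F \<in> \<Delta>\<^sub>2 \<Longrightarrow> F \<subseteq> V\<^sub>2"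
  using sc1 sc2 by (auto simp: simplicial_complex_def)

lemma face_subset: "F \<in> \<Delta>\<^sub>1 \<Longrightarrow> G \<subseteq> F \<Longrightarrow> G \<in> \<Delta>\<^sub>1" "F \<in> \<Delta>\<^sub>2 \<Longrightarrow> G \<subseteq> F \<Longrightarrow> G \<in> \<Delta>\<^sub>2"
  using sc1 sc2 by (simp_all add: simplicial_complex_def)

lemma simplicial_complex_union: "simplicial_complex V \<Delta>"
  unfolding simplicial_complex_def
  using finite_V1 finite_V2 empty_face by (auto dest: faces intro: face_subset)

lemma V1_nonempty: "V\<^sub>1 \<noteq> {}" and V2_nonempty: "V\<^sub>2 \<noteq> {}"
  using nontrivial1 nontrivial2 faces empty_face by blast+

text \<open>Singletons are faces, so a nonface has two vertices or more and one is left after the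
  removal of \<open>i\<close>.\<close>

lemma nonface_ge_2:
  assumes "N \<subseteq> V\<^sub>1" "N \<notin> \<Delta>\<^sub>1" shows "N \<noteq> {}" "N - {i} \<noteq> {}"
proof -
  show "N \<noteq> {}" using assms(2) empty_face by blast
  show "N - {i} \<noteq> {}"
  proof
    assume "N - {i} = {}"
    then have "N = {i}" using \<open>N \<noteq> {}\<close> by blast
    then show False using assms vertices1 by auto
  qed
qed

lemma separable_if_not_simplex:
  assumes "\<Delta>\<^sub>1 \<noteq> Pow V\<^sub>1"
  shows "separable TYPE('k::field) V \<Delta>"
proof -
  obtain N where N: "N \<subseteq> V\<^sub>1" "N \<notin> \<Delta>\<^sub>1" "\<And>v. v \<in> N \<Longrightarrow> N - {v} \<in> \<Delta>\<^sub>1"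
    by (rule minimal_nonface [OF sc1 assms]) blast
  obtain i where "i \<in> N" using nonface_ge_2 [OF N(1,2)] by blast
  then have i: "i \<in> V\<^sub>1" "i \<notin> V\<^sub>2" using N(1) disj by auto
  obtain q where q: "q \<in> V\<^sub>2" using V2_nonempty by blast
  then have q': "q \<notin> V\<^sub>1" "q \<noteq> i" using disj i by auto
  define E where "E = ext_vars V"
  \<comment> \<open>The maximal faces of \<open>\<Gamma>\<close> are \<open>F \<union> {y}\<close> and \<open>G \<union> {x\<^sub>i}\<close> for facets \<open>F\<close> of \<open>\<Delta>\<^sub>1\<close> and \<open>G\<close> of \<open>\<Delta>\<^sub>2\<close>.\<close>
  define \<Gamma> where "\<Gamma> = {F. F \<subseteq> E \<and> (Some -` F \<in> \<Delta>\<^sub>1 \<or> None \<notin> F \<and> Some -` F - {i} \<in> \<Delta>\<^sub>2)}"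
  have sc: "simplicial_complex E \<Gamma>"
    unfolding simplicial_complex_def
  proof (intro conjI ballI allI impI)
    show "finite E" using finite_V1 finite_V2 by (simp add: E_def ext_vars_def)
    show "\<Gamma> \<subseteq> Pow E" by (auto simp: \<Gamma>_def)
    show "{} \<in> \<Gamma>" by (simp add: \<Gamma>_def empty_face)
    fix F G assume "F \<in> \<Gamma>" "G \<subseteq> F"
    moreover have "Some -` G \<subseteq> Some -` F" "Some -` G - {i} \<subseteq> Some -` F - {i}"
      using \<open>G \<subseteq> F\<close> by auto
    ultimately show "G \<in> \<Gamma>" using face_subset unfolding \<Gamma>_def by blast
  qed
  define A where "A = nonface_expo E \<Gamma>"
  have A: "up_closed E A" unfolding A_def by (rule up_closed_nonface [OF sc])
  have keys_push: "keys (push i m) = Some -` keys m \<union> (if None \<in> keys m then {i} else {})" for m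
    by (force simp: keys_rename image_iff split: option.splits)
  have "push i ` A = nonface_expo V \<Delta>"
  proof (intro equalityI subsetI)
    fix m assume "m \<in> push i ` A"
    then obtain a where a: "m = push i a" "a \<in> expo E" "keys a \<notin> \<Gamma>"
      by (auto simp: A_def nonface_expo_def)
    have aE: "keys a \<subseteq> E" using a(2) by (simp add: expo_def)
    have "keys m \<subseteq> V" using aE i by (auto simp: a(1) keys_push E_def ext_vars_def)
    moreover have "keys m \<notin> \<Delta>\<^sub>1"
    proof
      assume "keys m \<in> \<Delta>\<^sub>1"
      then have "Some -` keys a \<in> \<Delta>\<^sub>1"
        by (rule face_subset) (auto simp: a(1) keys_push)
      then show False using a(3) aE by (simp add: \<Gamma>_def)
    qed
    moreover have "keys m \<notin> \<Delta>\<^sub>2"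
    proof
      assume m2: "keys m \<in> \<Delta>\<^sub>2"
      then have "None \<notin> keys a" using faces(2) i(2) by (fastforce simp: a(1) keys_push)
      moreover have "Some -` keys a - {i} \<in> \<Delta>\<^sub>2"
        using m2 by (rule face_subset) (auto simp: a(1) keys_push)
      ultimately show False using a(3) aE by (simp add: \<Gamma>_def)
    qed
    ultimately show "m \<in> nonface_expo V \<Delta>" by (simp add: nonface_expo_def expo_def)
  next
    fix m assume "m \<in> nonface_expo V \<Delta>"
    then have m: "keys m \<subseteq> V" "keys m \<notin> \<Delta>\<^sub>1" "keys m \<notin> \<Delta>\<^sub>2"
      by (auto simp: nonface_expo_def expo_def)
    \<comment> \<open>The lift of \<open>m\<close>: \<open>x_i\<close> becomes \<open>y\<close>
      exactly when a vertex of \<open>V\<^sub>2\<close> occurs in \<open>m\<close>.\<close>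
    define f where "f v = (if v = i \<and> keys m \<inter> V\<^sub>2 \<noteq> {} then None else Some v)" for v
    have "m = push i (rename f m)"
      by (rule push_rename [symmetric]) (auto simp: f_def)
    moreover have "rename f m \<in> A"
    proof -
      have "f ` keys m \<subseteq> E" using m(1) by (auto simp: f_def E_def ext_vars_def)
      moreover have "f ` keys m \<notin> \<Gamma>"
      proof (cases "keys m \<inter> V\<^sub>2 = {}")
        case True
        then have "Some -` f ` keys m = keys m" by (auto simp: f_def)
        moreover have "keys m \<subseteq> V\<^sub>1" using True m(1) by blast
        then have "keys m - {i} \<noteq> {}" using nonface_ge_2(2) m(2) by simp
        then have "keys m - {i} \<notin> \<Delta>\<^sub>2" using faces(2) True by blast
        ultimately show ?thesis using m(2) by (simp add: \<Gamma>_def)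
      next
        case False
        then have eq: "Some -` f ` keys m = keys m - {i}" and "None \<in> f ` keys m \<longleftrightarrow> i \<in> keys m"
          by (auto simp: f_def image_iff split: if_splits)
        moreover have "keys m - {i} \<notin> \<Delta>\<^sub>1" using False faces(1) disj i(2) by blast
        ultimately show ?thesis using m(3) by (auto simp: \<Gamma>_def eq)
      qed
      ultimately show ?thesis by (simp add: A_def nonface_expo_def expo_def keys_rename)
    qed
    ultimately show "m \<in> push i ` A" by blast
  qed
  \<comment> \<open>The unchanged generator on \<open>N\<close> is divisible by \<open>x_i\<close>,
    and the generator \<open>y x_q\<close> below by \<open>y\<close>; both are minimal.\<close>
  moreover have "min_expo A (sqfree (Some ` N))"
    unfolding A_def
  proof (rule min_expo_sqfree [OF sc])
    show "Some ` N \<subseteq> E" using N(1) by (auto simp: E_def ext_vars_def)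
    have vim: "Some -` Some ` M = M" for M :: "'v set" by auto
    have "N - {i} \<notin> \<Delta>\<^sub>2" using nonface_ge_2(2) [OF N(1,2), of i] N(1) faces(2) disj by blast
    then show "Some ` N \<notin> \<Gamma>" using N(2) by (auto simp: \<Gamma>_def vim)
    fix w assume "w \<in> Some ` N"
    then obtain v where v: "v \<in> N" "w = Some v" by blast
    have "Some -` (Some ` N - {w}) = N - {v}" by (auto simp: v(2))
    then have "Some -` (Some ` N - {w}) \<in> \<Delta>\<^sub>1" using N(3) [OF v(1)] by simp
    then show "Some ` N - {w} \<in> \<Gamma>"
      using \<open>Some ` N \<subseteq> E\<close> unfolding \<Gamma>_def by blast
  qed
  moreover have "Some i \<in> keys (sqfree (Some ` N))"
    using \<open>i \<in> N\<close> finite_subset [OF N(1) finite_V1] by (simp add: keys_sqfree)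
  moreover have "min_expo A (sqfree {None, Some q})"
    unfolding A_def
  proof (rule min_expo_sqfree [OF sc])
    show "{None, Some q} \<subseteq> E" using q by (simp add: E_def ext_vars_def)
    have vim: "Some -` {None, Some q} = {q}" "Some -` {None} = {}" "Some -` {Some q} = {q}" by auto
    have "{q} \<notin> \<Delta>\<^sub>1" using faces(1) q'(1) by blast
    then show "{None, Some q} \<notin> \<Gamma>" by (simp add: \<Gamma>_def vim)
    have "{q} - {i} = {q}" using q'(2) by auto
    then show "{None, Some q} - {v} \<in> \<Gamma>" if "v \<in> {None, Some q}" for v
      using that \<open>{None, Some q} \<subseteq> E\<close> vertices2 q
      by (auto simp: \<Gamma>_def vim empty_face insert_Diff_if)
  qed
  moreover have "None \<in> keys (sqfree {None, Some q})" by (simp add: keys_sqfree)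
  moreover have "f \<in> polys A"
    if "f \<in> polys (expo E)" "(X None - X (Some i)) * f \<in> polys A" for f :: "('v option, 'k) mpoly"
    unfolding A_def
  proof (rule nonzerodivisor_difference [OF sc])
    show "Some i \<in> E" "None \<in> E" using i by (auto simp: E_def ext_vars_def)
    \<comment> \<open>If the part of \<open>F\<close> in \<open>V\<close> is a face of
      \<open>\<Delta>\<^sub>1\<close>, then \<open>y\<close> can be added. Otherwise
      \<open>F\<close> avoids \<open>y\<close> and is, up to \<open>x_i\<close>, a face of
      \<open>\<Delta>\<^sub>2\<close>, so \<open>x_i\<close> can be added.\<close>
    show "insert (Some i) F \<in> \<Gamma> \<or> insert None F \<in> \<Gamma>" if "F \<in> \<Gamma>" for F
    proof (cases "Some -` F \<in> \<Delta>\<^sub>1")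
      case True
      have "Some -` insert None F = Some -` F" by auto
      then show ?thesis using True that \<open>None \<in> E\<close> by (simp add: \<Gamma>_def)
    next
      case False
      have "Some -` insert (Some i) F - {i} = Some -` F - {i}" by auto
      then show ?thesis using False that \<open>Some i \<in> E\<close> by (simp add: \<Gamma>_def)
    qed
  qed (use that in \<open>simp_all add: A_def\<close>)
  ultimately have "is_separation V (polys (nonface_expo V \<Delta>) :: ('v, 'k) mpoly set) i (polys A)"
    using A i unfolding E_def by (subst is_separation_iff) auto
  then show ?thesis
    using i unfolding separable_def SR_ideal_eq [OF simplicial_complex_union] by blast
qed

lemma inseparable_if_simplices:
  assumes "\<Delta>\<^sub>1 = Pow V\<^sub>1" "\<Delta>\<^sub>2 = Pow V\<^sub>2"
  shows "inseparable TYPE('k::field) V \<Delta>"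
proof -
  have "\<not> is_separation V (polys (nonface_expo V \<Delta>) :: ('v, 'k) mpoly set) i J" if "i \<in> V" for i J
  proof (cases "i \<in> V\<^sub>1")
    case True
    then show ?thesis unfolding assms by (rule no_separation_of_simplices [OF disj])
  next
    case False
    then have "i \<in> V\<^sub>2" using that by simp
    moreover have "V\<^sub>2 \<inter> V\<^sub>1 = {}" using disj by blast
    ultimately show ?thesis
      using no_separation_of_simplices [of V\<^sub>2 V\<^sub>1 i J] unfolding assms by (simp add: Un_commute)
  qed
  then show ?thesis
    unfolding separable_def SR_ideal_eq [OF simplicial_complex_union] by blast
qed

lemma inseparable_iff:
  "inseparable TYPE('k::field) V \<Delta> \<longleftrightarrow> is_simplex V\<^sub>1 \<Delta>\<^sub>1 \<and> is_simplex V\<^sub>2 \<Delta>\<^sub>2"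
  using inseparable_if_simplices [where 'k = 'k] separable_if_not_simplex [where 'k = 'k]
    disjoint_complexes.separable_if_not_simplex [OF commute, where 'k = 'k]
  unfolding is_simplex_def by (metis Un_commute)

end

subsection \<open>Homomorphisms into the quotient and derivations\<close>

abbreviation coset :: "'v set \<Rightarrow> ('v \<Rightarrow>\<^sub>0 nat) set \<Rightarrow> ('v, 'k::field) mpoly \<Rightarrow> ('v, 'k) mpoly set" where
  "coset V A f \<equiv> polys A +>\<^bsub>poly_ring V\<^esub> f"

lemma coset_eq_iff:
  assumes "up_closed V A" "f \<in> polys (expo V)" "g \<in> polys (expo V)"
  shows "coset V A f = coset V A g \<longleftrightarrow> f - g \<in> polys A"
proof -
  interpret cring "poly_ring V" by (rule cring_poly_ring)
  show ?thesis
    using quotient_eq_iff_same_a_r_cos [OF ideal_polys [OF assms(1)], of f g] assms(2,3)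
    by (simp add: carrier_poly_ring poly_ring_minus)
qed

lemma quot_ops:
  assumes "up_closed V A" "f \<in> polys (expo V)" "g \<in> polys (expo V)"
  shows "coset V A f \<oplus>\<^bsub>poly_ring V Quot polys A\<^esub> coset V A g = coset V A (f + g)"
    and "coset V A f \<otimes>\<^bsub>poly_ring V Quot polys A\<^esub> coset V A g = coset V A (f * g)"
proof -
  interpret ideal "polys A" "poly_ring V" by (rule ideal_polys [OF assms(1)])
  show "coset V A f \<oplus>\<^bsub>poly_ring V Quot polys A\<^esub> coset V A g = coset V A (f + g)"
    using a_rcos_sum [of f g] assms(2,3) by (simp add: FactRing_def carrier_poly_ring)
  show "coset V A f \<otimes>\<^bsub>poly_ring V Quot polys A\<^esub> coset V A g = coset V A (f * g)"
    using rcoset_mult_add [of f g] assms(2,3) by (simp add: FactRing_def carrier_poly_ring)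
qed

lemma quot_carrier:
  "carrier (poly_ring V Quot polys A) = coset V A ` polys (expo V)"
  by (auto simp: FactRing_def A_RCOSETS_defs a_r_coset_def carrier_poly_ring)

lemma quot_zero:
  assumes "up_closed V A"
  shows "\<zero>\<^bsub>poly_ring V Quot polys A\<^esub> = coset V A (0 :: ('v, 'k::field) mpoly)"
proof -
  interpret ideal "polys A :: ('v, 'k) mpoly set" "poly_ring V" by (rule ideal_polys [OF assms])
  have "coset V A (0 :: ('v, 'k) mpoly) = polys A"
    by (rule a_coset_join2 [OF _ a_subgroup]) (simp_all add: carrier_poly_ring)
  then show ?thesis by (simp add: FactRing_def)
qed

abbreviation Homs :: "'v set \<Rightarrow> ('v \<Rightarrow>\<^sub>0 nat) set \<Rightarrow> (('v, 'k::field) mpoly \<Rightarrow> ('v, 'k) mpoly set) set" where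
  "Homs V A \<equiv> carrier (Hom_quot (poly_ring V) (polys A))"

lemma up_closed_polys: "up_closed V A \<Longrightarrow> f \<in> polys A \<Longrightarrow> f \<in> polys (expo V)"
  by (auto simp: up_closed_def intro: polys_mono)

lemma polys_ideal_mult:
  assumes "up_closed V A" "r \<in> polys (expo V)" "f \<in> polys A"
  shows "r * f \<in> polys A"
  by (rule polys_mult [OF assms(2,3)]) (use assms(1) in \<open>auto simp: up_closed_def\<close>)

text \<open>A lift \<open>\<psi>\<close> to polynomials has to respect multiplication only modulo
  the ideal; the defect disappears in the quotient.\<close>

lemma Hom_quotI:
  fixes \<psi> :: "('v, 'k::field) mpoly \<Rightarrow> ('v, 'k) mpoly"
  assumes A: "up_closed V A"
    and closed: "\<And>f. f \<in> polys A \<Longrightarrow> \<psi> f \<in> polys (expo V)"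
    and add: "\<And>f g. f \<in> polys A \<Longrightarrow> g \<in> polys A \<Longrightarrow> \<psi> (f + g) = \<psi> f + \<psi> g"
    and mult: "\<And>r f. r \<in> polys (expo V) \<Longrightarrow> f \<in> polys A \<Longrightarrow> \<psi> (r * f) - r * \<psi> f \<in> polys A"
  shows "(\<lambda>f\<in>polys A. coset V A (\<psi> f)) \<in> Homs V A"
proof -
  have "coset V A (\<psi> (r * f)) = coset V A (r * \<psi> f)" if "r \<in> polys (expo V)" "f \<in> polys A" for r f
    using mult [OF that] closed [OF that(2)] closed [OF polys_ideal_mult [OF A that]]
      expo_polys_mult [OF that(1) closed [OF that(2)]]
    by (simp add: coset_eq_iff [OF A])
  then show ?thesis
    using closed
    by (auto simp: Hom_quot_def quot_carrier carrier_poly_ring polys_add polys_ideal_mult [OF A]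
        quot_ops [OF A] add)
qed

lemma Hom_quotD:
  assumes "\<phi> \<in> Homs V A"
  shows "f \<in> polys A \<Longrightarrow> \<phi> f \<in> carrier (poly_ring V Quot polys A)"
    and "\<phi> \<in> extensional (polys A)"
    and "f \<in> polys A \<Longrightarrow> g \<in> polys A \<Longrightarrow> \<phi> (f + g) = \<phi> f \<oplus>\<^bsub>poly_ring V Quot polys A\<^esub> \<phi> g"
    and "r \<in> polys (expo V) \<Longrightarrow> f \<in> polys A \<Longrightarrow>
      \<phi> (r * f) = coset V A r \<otimes>\<^bsub>poly_ring V Quot polys A\<^esub> \<phi> f"
  using assms by (auto simp: Hom_quot_def carrier_poly_ring PiE_def)

text \<open>A homomorphism is determined by its values on generators. Here \<open>gen\<close>
  provides, below each exponent of the ideal, one where both agree, and linearity pulls out the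
  cofactor.\<close>

lemma Hom_quot_eqI:
  fixes \<phi> \<psi> :: "('v, 'k::field) mpoly \<Rightarrow> ('v, 'k) mpoly set"
  assumes A: "up_closed V A" and \<phi>: "\<phi> \<in> Homs V A" and \<psi>: "\<psi> \<in> Homs V A"
    and gen: "\<And>m. m \<in> A \<Longrightarrow> \<exists>u g. m = u + g \<and> g \<in> A \<and> \<phi> (monom g) = \<psi> (monom g)"
  shows "\<phi> = \<psi>"
proof (rule extensionalityI [OF Hom_quotD(2) [OF \<phi>] Hom_quotD(2) [OF \<psi>]])
  interpret quot: ring "poly_ring V Quot polys A :: ('v, 'k) mpoly set ring"
    by (rule ideal.quotient_is_ring [OF ideal_polys [OF A]])
  fix f :: "('v, 'k) mpoly"
  assume "f \<in> polys A"
  then show "\<phi> f = \<psi> f"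
  proof (induction f rule: polys_induct)
    case zero
    \<comment> \<open>Since \<open>0 = 0 * 0\<close>, linearity yields the value at 0.\<close>
    have "\<chi> 0 = \<zero>\<^bsub>poly_ring V Quot polys A\<^esub>" if "\<chi> \<in> Homs V A"
      for \<chi> :: "('v, 'k) mpoly \<Rightarrow> ('v, 'k) mpoly set"
      using Hom_quotD(1) [OF that, of 0] Hom_quotD(4) [OF that, of 0 0]
      by (simp add: quot_zero [OF A, symmetric])
    from this [OF \<phi>] this [OF \<psi>] show ?case by simp
  next
    case (monom c m)
    then obtain u g where g: "m = u + g" "g \<in> A" "\<phi> (monom g) = \<psi> (monom g)"
      using gen by blast
    have "u \<in> expo V" using monom g(1) A by (auto simp: up_closed_def)
    then have "const_poly c * monom u \<in> polys (expo V)" by (simp add: polys_const_mult)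
    then show ?case
      using Hom_quotD(4) [OF \<phi>, of "const_poly c * monom u" "monom g"]
        Hom_quotD(4) [OF \<psi>, of "const_poly c * monom u" "monom g"] g
      by (simp add: monom_add mult.assoc)
  next
    case (add p q)
    then show ?case using Hom_quotD(3) [OF \<phi>] Hom_quotD(3) [OF \<psi>] by simp
  qed
qed

lemma derivationsD:
  assumes "d \<in> derivations V"
  shows "p \<in> polys (expo V) \<Longrightarrow> d p \<in> polys (expo V)"
    and "p \<in> polys (expo V) \<Longrightarrow> q \<in> polys (expo V) \<Longrightarrow> d (p + q) = d p + d q"
    and "p \<in> polys (expo V) \<Longrightarrow> q \<in> polys (expo V) \<Longrightarrow> d (p * q) = p * d q + q * d p"
    and "p \<in> polys (expo V) \<Longrightarrow> d (const_poly c * p) = const_poly c * d p"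
  using assms unfolding derivations_def carrier_poly_ring by auto

text \<open>By the Leibniz rule \<open>d (r * f) - r * d f = d r * f\<close>, which lies in the
  ideal together with \<open>f\<close>.\<close>

lemma delta_star_in_Homs:
  fixes d :: "('v, 'k::field) mpoly \<Rightarrow> ('v, 'k) mpoly"
  assumes A: "up_closed V A" and d: "d \<in> derivations V"
  shows "delta_star V (polys A) d \<in> Homs V A"
  unfolding delta_star_def
proof (rule Hom_quotI [OF A])
  fix r f :: "('v, 'k) mpoly"
  assume "r \<in> polys (expo V)" "f \<in> polys A"
  then have "d (r * f) - r * d f = d r * f"
    using derivationsD(3) [OF d, of r f] up_closed_polys [OF A, of f]
    by (simp add: mult.commute)
  then show "d (r * f) - r * d f \<in> polys A"
    using polys_ideal_mult [OF A derivationsD(1) [OF d]] \<open>r \<in> _\<close> \<open>f \<in> _\<close> by simp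
next
  fix f :: "('v, 'k) mpoly"
  assume f: "f \<in> polys A"
  then show "d f \<in> polys (expo V)" by (rule derivationsD(1) [OF d up_closed_polys [OF A]])
  fix g :: "('v, 'k) mpoly"
  assume "g \<in> polys A"
  with f show "d (f + g) = d f + d g" by (intro derivationsD(2) [OF d] up_closed_polys [OF A])
qed

section \<open>Vanishing of the cokernel\<close>

lemma derivation_comb:
  assumes d: "d \<in> derivations V" and d': "d' \<in> derivations V"
  shows "(\<lambda>p\<in>polys (expo V). d p + d' p) \<in> derivations V" (is "?s \<in> _")
    and "(\<lambda>p\<in>polys (expo V). d p - d' p) \<in> derivations V" (is "?t \<in> _")
  using derivationsD [OF d] derivationsD [OF d']
  unfolding derivations_def carrier_poly_ring
  by (auto simp: polys_add polys_diff polys_const_mult expo_polys_mult)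
    (simp_all add: algebra_simps)

text \<open>The maps induced by derivations contain zero and are closed under sums and differences,
  so a coset of \<open>H\<close> is trivial just when its representative belongs to
  \<open>H\<close>.\<close>

lemma coset_image_derivations:
  fixes \<phi> :: "('v, 'k::field) mpoly \<Rightarrow> ('v, 'k) mpoly set"
  assumes A: "up_closed V A" and \<phi>: "\<phi> \<in> Homs V A"
  defines "H \<equiv> delta_star V (polys A) ` derivations V"
  shows "H #>\<^bsub>Hom_quot (poly_ring V) (polys A)\<^esub> \<phi> = H \<longleftrightarrow> \<phi> \<in> H"
proof
  have carr: "f \<in> polys (expo V)" if "f \<in> polys A" for f :: "('v, 'k) mpoly"
    using up_closed_polys [OF A that] .
  have mult: "\<chi> \<otimes>\<^bsub>Hom_quot (poly_ring V) (polys A)\<^esub> \<phi> =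
      (\<lambda>f\<in>polys A. \<chi> f \<oplus>\<^bsub>poly_ring V Quot polys A\<^esub> \<phi> f)" for \<chi> \<phi> :: "('v, 'k) mpoly \<Rightarrow> ('v, 'k) mpoly set"
    by (simp add: Hom_quot_def)
  {
    assume eq: "H #>\<^bsub>Hom_quot (poly_ring V) (polys A)\<^esub> \<phi> = H"
    interpret quot: ring "poly_ring V Quot polys A :: ('v, 'k) mpoly set ring"
      by (rule ideal.quotient_is_ring [OF ideal_polys [OF A]])
    have "(\<lambda>p\<in>polys (expo V). 0) \<in> (derivations V :: (('v, 'k) mpoly \<Rightarrow> ('v, 'k) mpoly) set)"
      by (auto simp: derivations_def carrier_poly_ring polys_add polys_const_mult expo_polys_mult)
    then have zero: "delta_star V (polys A) (\<lambda>p\<in>polys (expo V). 0) \<in> H" by (simp add: H_def)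
    have "delta_star V (polys A) (\<lambda>p\<in>polys (expo V). 0) \<otimes>\<^bsub>Hom_quot (poly_ring V) (polys A)\<^esub> \<phi>
        \<in> H #>\<^bsub>Hom_quot (poly_ring V) (polys A)\<^esub> \<phi>"
      using zero unfolding r_coset_def by blast
    moreover have "delta_star V (polys A) (\<lambda>p\<in>polys (expo V). 0) \<otimes>\<^bsub>Hom_quot (poly_ring V) (polys A)\<^esub> \<phi> = \<phi>"
      unfolding mult
    proof (rule extensionalityI [OF restrict_extensional Hom_quotD(2) [OF \<phi>]])
      fix f :: "('v, 'k) mpoly"
      assume "f \<in> polys A"
      then show "(\<lambda>f\<in>polys A. delta_star V (polys A) (\<lambda>p\<in>polys (expo V). 0) f
          \<oplus>\<^bsub>poly_ring V Quot polys A\<^esub> \<phi> f) f = \<phi> f"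
        using Hom_quotD(1) [OF \<phi>] carr
        by (simp add: delta_star_def quot_zero [OF A, symmetric])
    qed
    ultimately show "\<phi> \<in> H" by (simp only: eq)
  }
  assume "\<phi> \<in> H"
  then obtain e where e: "e \<in> derivations V" "\<phi> = delta_star V (polys A) e" by (auto simp: H_def)
  have add: "delta_star V (polys A) d \<otimes>\<^bsub>Hom_quot (poly_ring V) (polys A)\<^esub> \<phi> =
      delta_star V (polys A) (\<lambda>p\<in>polys (expo V). d p + e p)" if "d \<in> derivations V" for d
    unfolding mult e(2) delta_star_def
    using derivationsD(1) [OF that] derivationsD(1) [OF e(1)] carr
    by (intro restrict_ext) (simp add: quot_ops [OF A])
  show "H #>\<^bsub>Hom_quot (poly_ring V) (polys A)\<^esub> \<phi> = H"
  proof
    show "H #>\<^bsub>Hom_quot (poly_ring V) (polys A)\<^esub> \<phi> \<subseteq> H"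
      using derivation_comb(1) [OF _ e(1)] unfolding H_def r_coset_def by (auto simp: add)
    show "H \<subseteq> H #>\<^bsub>Hom_quot (poly_ring V) (polys A)\<^esub> \<phi>"
    proof
      fix \<chi> assume "\<chi> \<in> H"
      then obtain d where d: "d \<in> derivations V" "\<chi> = delta_star V (polys A) d" by (auto simp: H_def)
      define d' where "d' = (\<lambda>p\<in>polys (expo V). d p - e p)"
      have d': "d' \<in> derivations V" unfolding d'_def by (rule derivation_comb(2) [OF d(1) e(1)])
      have "\<chi> = delta_star V (polys A) d' \<otimes>\<^bsub>Hom_quot (poly_ring V) (polys A)\<^esub> \<phi>"
        unfolding add [OF d'] d(2) unfolding delta_star_def
        using carr by (intro restrict_ext) (simp add: d'_def)
      then show "\<chi> \<in> H #>\<^bsub>Hom_quot (poly_ring V) (polys A)\<^esub> \<phi>"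
        using d' unfolding H_def r_coset_def by blast
    qed
  qed
qed

text \<open>Every degree contains the zero homomorphism, so its image in the cokernel is never empty
  and equals zero as soon as each member is trivial.\<close>

lemma zero_in_Hom_comp:
  assumes A: "up_closed V A"
  shows "(\<lambda>f\<in>polys A. coset V A 0) \<in> Hom_comp V (polys A) a"
  unfolding Hom_comp_def
proof (intro CollectI conjI allI)
  show "(\<lambda>f\<in>polys A. coset V A 0) \<in> Homs V A"
    by (rule Hom_quotI [OF A]) auto
  have "0 \<in> poly_comp V (\<lambda>v. c v + a v)" for c
    by (simp add: poly_comp_def carrier_poly_ring)
  then show "(\<lambda>f\<in>polys A. coset V A 0) ` (polys A \<inter> poly_comp V c)
      \<subseteq> coset V A ` poly_comp V (\<lambda>v. c v + a v)" for c
    by auto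
qed

lemma image_eq_singleton: "S \<noteq> {} \<Longrightarrow> f ` S = {c} \<longleftrightarrow> (\<forall>x\<in>S. f x = c)"
  by auto

text \<open>The unit of \<open>T1\<close> is the subgroup of maps induced by derivations, and its
  elements are the cosets of that subgroup.\<close>

lemma rigid_iff:
  assumes sc: "simplicial_complex V \<Delta>"
  shows "rigid TYPE('k::field) V \<Delta> \<longleftrightarrow>
    Homs V (nonface_expo V \<Delta>) \<subseteq>
      delta_star V (polys (nonface_expo V \<Delta>)) ` (derivations V :: (('v, 'k) mpoly \<Rightarrow> ('v, 'k) mpoly) set)"
proof -
  define A where "A = nonface_expo V \<Delta>"
  have A: "up_closed V A" unfolding A_def by (rule up_closed_nonface [OF sc])
  define H :: "(('v, 'k) mpoly \<Rightarrow> ('v, 'k) mpoly set) set"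
    where "H = delta_star V (polys A) ` derivations V"
  have "carrier (T1 V (polys A :: ('v, 'k) mpoly set)) =
      (\<lambda>\<phi>. H #>\<^bsub>Hom_quot (poly_ring V) (polys A)\<^esub> \<phi>) ` Homs V A"
    by (auto simp: T1_def FactGroup_def RCOSETS_def H_def)
  moreover have "\<one>\<^bsub>T1 V (polys A)\<^esub> = H" by (simp add: T1_def FactGroup_def H_def)
  moreover have "Homs V A \<noteq> ({} :: (('v, 'k) mpoly \<Rightarrow> ('v, 'k) mpoly set) set)"
  proof -
    have "(\<lambda>f\<in>polys A. coset V A (0 :: ('v, 'k) mpoly)) \<in> Hom_comp V (polys A) (\<lambda>_. 0)"
      by (rule zero_in_Hom_comp [OF A])
    then show ?thesis unfolding Hom_comp_def by blast
  qed
  ultimately have "rigid TYPE('k) V \<Delta> \<longleftrightarrow> (\<forall>\<phi>\<in>Homs V A. \<phi> \<in> H)"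
    unfolding rigid_def SR_ideal_eq [OF sc] A_def [symmetric] Let_def
    by (simp add: image_eq_singleton H_def coset_image_derivations [OF A])
  then show ?thesis by (auto simp: A_def H_def)
qed

lemma empty_rigid_iff:
  assumes sc: "simplicial_complex V \<Delta>"
  shows "empty_rigid TYPE('k::field) V \<Delta> \<longleftrightarrow>
    (\<forall>b \<in> V \<rightarrow> {0, 1}. Hom_comp V (polys (nonface_expo V \<Delta>)) (\<lambda>v. - b v) \<subseteq>
      delta_star V (polys (nonface_expo V \<Delta>)) ` (derivations V :: (('v, 'k) mpoly \<Rightarrow> ('v, 'k) mpoly) set))"
proof -
  define A where "A = nonface_expo V \<Delta>"
  have A: "up_closed V A" unfolding A_def by (rule up_closed_nonface [OF sc])
  define H :: "(('v, 'k) mpoly \<Rightarrow> ('v, 'k) mpoly set) set"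
    where "H = delta_star V (polys A) ` derivations V"
  have one: "\<one>\<^bsub>T1 V (polys A)\<^esub> = H" by (simp add: T1_def FactGroup_def H_def)
  have "T1_comp V (polys A) a = {H} \<longleftrightarrow> (\<forall>\<phi>\<in>Hom_comp V (polys A) a. \<phi> \<in> H)" for a
  proof -
    have ne: "Hom_comp V (polys A) a \<noteq> ({} :: (('v, 'k) mpoly \<Rightarrow> ('v, 'k) mpoly set) set)"
      using zero_in_Hom_comp [OF A] by auto
    have "\<phi> \<in> Homs V A" if "\<phi> \<in> Hom_comp V (polys A) a"
      for \<phi> :: "('v, 'k) mpoly \<Rightarrow> ('v, 'k) mpoly set"
      using that by (simp add: Hom_comp_def)
    then show ?thesis
      unfolding T1_comp_def H_def [symmetric] image_eq_singleton [OF ne]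
      by (auto simp: H_def coset_image_derivations [OF A])
  qed
  then have "empty_rigid TYPE('k) V \<Delta> \<longleftrightarrow>
      (\<forall>b \<in> V \<rightarrow> {0, 1}. \<forall>\<phi>\<in>Hom_comp V (polys A) (\<lambda>v. - b v). \<phi> \<in> H)"
    unfolding empty_rigid_def SR_ideal_eq [OF sc] A_def [symmetric] Let_def one by simp
  then show ?thesis unfolding A_def H_def subset_iff by blast
qed

lemma empty_rigid_if_rigid:
  assumes "simplicial_complex V \<Delta>" "rigid TYPE('k::field) V \<Delta>"
  shows "empty_rigid TYPE('k) V \<Delta>"
  using assms(2) unfolding rigid_iff [OF assms(1)] empty_rigid_iff [OF assms(1)] Hom_comp_def by blast

subsection \<open>Rigidity of disjoint unions\<close>

text \<open>The sum of the \<open>g v\<close> times d/dx_v. Truncation in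
  \<open>m - single v 1\<close> does no harm: the coefficient is 0 whenever \<open>v\<close> does
  not occur in \<open>m\<close>.\<close>

definition vector_field :: "'v set \<Rightarrow> ('v \<Rightarrow> ('v, 'k::field) mpoly) \<Rightarrow> ('v, 'k) mpoly \<Rightarrow> ('v, 'k) mpoly" where
  "vector_field V g = lin (\<lambda>m. \<Sum>v\<in>V. const_poly (of_nat (lookup m v)) * monom (m - single v 1) * g v)"

text \<open>The Leibniz rule holds for two monomials because exponents add, and extends by
  linearity, first in \<open>q\<close> and then in \<open>p\<close>.\<close>

lemma vector_field_mult:
  fixes g :: "'v \<Rightarrow> ('v, 'k::field) mpoly"
  shows "vector_field V g (p * q) = p * vector_field V g q + q * vector_field V g p"
proof -
  define T where "T m = (\<Sum>v\<in>V. const_poly (of_nat (lookup m v)) * monom (m - single v 1) * g v)" for m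
  have half: "const_poly (of_nat (lookup m v)) * monom (m + n - single v 1) =
      (const_poly (of_nat (lookup m v)) * monom n * monom (m - single v 1) :: ('v, 'k) mpoly)" for m n v
  proof (cases "v \<in> keys m")
    case True
    then obtain u where "m = single v 1 + u" using keys_add_single [of v m] by auto
    then show ?thesis by (simp add: add.assoc monom_add mult.assoc mult.commute mult.left_commute)
  qed (simp add: in_keys_iff)
  have T_add: "T (m + n) = monom m * T n + monom n * T m" for m n
  proof -
    have "T (m + n) = (\<Sum>v\<in>V. (const_poly (of_nat (lookup m v)) * monom (m + n - single v 1) +
        const_poly (of_nat (lookup n v)) * monom (n + m - single v 1)) * g v)"
      by (simp add: T_def lookup_add const_poly_add algebra_simps)
    also have "\<dots> = (\<Sum>v\<in>V. monom m * (const_poly (of_nat (lookup n v)) * monom (n - single v 1) * g v) +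
        monom n * (const_poly (of_nat (lookup m v)) * monom (m - single v 1) * g v))"
      unfolding half by (simp add: algebra_simps)
    also have "\<dots> = monom m * T n + monom n * T m"
      by (simp add: T_def sum.distrib sum_distrib_left)
    finally show ?thesis .
  qed
  have mono: "lin T (monom m * q) = monom m * lin T q + q * T m" for m q
  proof (induction q rule: mpoly_induct)
    case (monom c n)
    have "monom m * (const_poly c * monom n) = const_poly c * monom (m + n)"
      by (simp add: monom_add mult.left_commute)
    then show ?case by (simp add: lin_const_mult T_add algebra_simps)
  qed (simp_all add: lin_add algebra_simps)
  have "lin T (p * q) = p * lin T q + q * lin T p"
  proof (induction p rule: mpoly_induct)
    case (monom c m)
    have "lin T (const_poly c * monom m * q) = const_poly c * (monom m * lin T q + q * T m)"
      unfolding mult.assoc lin_const_mult mono ..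
    then show ?case by (simp add: lin_const_mult algebra_simps)
  qed (simp_all add: lin_add algebra_simps)
  moreover have "vector_field V g = lin T" by (simp only: vector_field_def T_def [abs_def])
  ultimately show ?thesis by simp
qed

lemma vector_field_X:
  assumes "finite V" "w \<in> V" shows "vector_field V g (X w) = g w"
proof -
  have "vector_field V g (X w) = (\<Sum>v\<in>V. if v = w then g v else 0)"
    unfolding vector_field_def X_def lin_monom
    by (rule sum.cong) (auto simp: lookup_single)
  then show ?thesis using assms by simp
qed

lemma expo_diff: "m \<in> expo V \<Longrightarrow> m - n \<in> expo V"
  by (auto simp: expo_def in_keys_iff lookup_minus)

lemma vector_field_derivation:
  fixes V :: "'v set"
  assumes "\<And>v. v \<in> V \<Longrightarrow> g v \<in> polys (expo V)"
  shows "(\<lambda>p\<in>polys (expo V). vector_field V g p) \<in> derivations V"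
proof -
  have "vector_field V g p \<in> polys (expo V)" if "p \<in> polys (expo V)" for p
    unfolding vector_field_def using that assms
    by (intro lin_in_polys polys_sum expo_polys_mult polys_const_mult) (auto intro: expo_diff)
  moreover have "vector_field V g (p + q) = vector_field V g p + vector_field V g q"
    "vector_field V g (const_poly c * p) = const_poly c * vector_field V g p" for p q c
    by (simp_all add: vector_field_def lin_add lin_const_mult)
  ultimately show ?thesis
    unfolding derivations_def carrier_poly_ring
    using vector_field_mult [of V g] by (simp add: polys_add polys_const_mult expo_polys_mult)
qed

section \<open>Homogeneous homomorphisms that divide by a monomial\<close>

definition shift_down :: "('v \<Rightarrow>\<^sub>0 nat) set \<Rightarrow> ('v \<Rightarrow>\<^sub>0 nat) \<Rightarrow> ('v \<Rightarrow>\<^sub>0 nat) \<Rightarrow> ('v, 'k::field) mpoly" where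
  "shift_down D s m = (if m \<in> D then monom (m - s) else 0)"

lemma lin_mult_mod:
  fixes r f :: "('v, 'k::field) mpoly" and T :: "('v \<Rightarrow>\<^sub>0 nat) \<Rightarrow> ('v, 'k) mpoly"
  assumes T: "\<And>u m. u \<in> expo V \<Longrightarrow> m \<in> A \<Longrightarrow> T (u + m) - monom u * T m \<in> polys A"
    and r: "r \<in> polys (expo V)" and f: "f \<in> polys A"
  shows "lin T (r * f) - r * lin T f \<in> polys A"
  using r
proof (induction r rule: polys_induct)
  case (monom c u)
  have "lin T (monom u * f) - monom u * lin T f \<in> polys A"
    using f
  proof (induction f rule: polys_induct)
    case (monom b m)
    have "monom u * (const_poly b * monom m) = const_poly b * (monom (u + m) :: ('v, 'k) mpoly)"
      by (simp add: monom_add mult.left_commute)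
    then have "lin T (monom u * (const_poly b * monom m)) - monom u * lin T (const_poly b * monom m) =
        const_poly b * (T (u + m) - monom u * T m)"
      by (simp add: lin_const_mult algebra_simps)
    then show ?case using polys_const_mult [OF T [OF \<open>u \<in> expo V\<close> monom]] by simp
  next
    case (add p q)
    have "lin T (monom u * (p + q)) - monom u * lin T (p + q) =
        (lin T (monom u * p) - monom u * lin T p) + (lin T (monom u * q) - monom u * lin T q)"
      by (simp add: lin_add algebra_simps)
    then show ?case using add polys_add by metis
  qed simp
  moreover have "lin T (const_poly c * monom u * f) - const_poly c * monom u * lin T f =
      const_poly c * (lin T (monom u * f) - monom u * lin T f)"
    unfolding mult.assoc lin_const_mult by (simp add: right_diff_distrib)
  ultimately show ?case using polys_const_mult by metis
next
  case (add p q)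
  have "lin T ((p + q) * f) - (p + q) * lin T f =
      (lin T (p * f) - p * lin T f) + (lin T (q * f) - q * lin T f)"
    by (simp add: lin_add algebra_simps)
  then show ?case using add polys_add by metis
qed simp

text \<open>Monomials in \<open>D\<close> are divided by the squarefree monomial on
  \<open>S\<close>, the others go to 0. Linearity can fail only where multiplication leads into
  \<open>D\<close> from outside, and there \<open>boundary\<close> puts the quotient into the
  ideal.\<close>

lemma shift_in_Hom_comp:
  assumes A: "up_closed V A" and S: "finite S" "S \<subseteq> V"
    and DA: "D \<subseteq> A" and DS: "\<And>m. m \<in> D \<Longrightarrow> S \<subseteq> keys m"
    and up: "\<And>u m. u \<in> expo V \<Longrightarrow> m \<in> D \<Longrightarrow> u + m \<in> D"
    and boundary: "\<And>u m. u \<in> expo V \<Longrightarrow> m \<in> A \<Longrightarrow> m \<notin> D \<Longrightarrow> u + m \<in> D \<Longrightarrow> u + m - sqfree S \<in> A"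
  shows "(\<lambda>f\<in>polys A. coset V A (lin (shift_down D (sqfree S)) f :: ('v, 'k::field) mpoly))
    \<in> Hom_comp V (polys A) (\<lambda>v. - (if v \<in> S then 1 else 0))"
proof -
  define T :: "('v \<Rightarrow>\<^sub>0 nat) \<Rightarrow> ('v, 'k) mpoly" where "T = shift_down D (sqfree S)"
  have split: "\<exists>u. m = u + sqfree S" if "m \<in> D" for m
    using sqfree_divides [OF S(1) DS [OF that]] .
  have T_in: "T m \<in> polys (expo V)" if "m \<in> A" for m
    using that A by (auto simp: T_def shift_down_def up_closed_def intro: expo_diff)
  have closed: "lin T f \<in> polys (expo V)" if "f \<in> polys A" for f
    using that T_in by (rule lin_in_polys)
  have T_mult: "T (u + m) - monom u * T m \<in> polys A" if um: "u \<in> expo V" "m \<in> A" for u m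
  proof (cases "m \<in> D")
    case True
    then obtain w where "m = w + sqfree S" using split by blast
    then have "u + m - sqfree S = u + (m - sqfree S)" by (simp add: add.assoc [symmetric])
    then show ?thesis using True up [OF um(1) True] by (simp add: T_def shift_down_def monom_add)
  next
    case False
    then show ?thesis using boundary [OF um False] by (simp add: T_def shift_down_def)
  qed
  have "(\<lambda>f\<in>polys A. coset V A (lin T f)) \<in> Homs V A"
    using closed lin_mult_mod [OF T_mult] by (intro Hom_quotI [OF A]) (auto simp: lin_add)
  moreover have "lin T f \<in> poly_comp V (\<lambda>v. c v + - (if v \<in> S then 1 else 0))"
    if f: "f \<in> polys A" "f \<in> poly_comp V c" for f c
  proof -
    \<comment> \<open>Homogeneous components are spans of monomials too, so the degree shift is
      checked on exponents.\<close>
    define C where "C a = {m \<in> expo V. \<forall>v\<in>V. int (lookup m v) = a v}" for a :: "'v \<Rightarrow> int"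
    have comp: "poly_comp V a = (polys (C a) :: ('v, 'k) mpoly set)" for a
      by (auto simp: poly_comp_def carrier_poly_ring polys_def C_def)
    have "f \<in> polys (A \<inter> C c)" using f by (auto simp: comp polys_def)
    then have "lin T f \<in> polys (C (\<lambda>v. c v + - (if v \<in> S then 1 else 0)))"
    proof (rule lin_in_polys)
      fix m assume m: "m \<in> A \<inter> C c"
      show "T m \<in> polys (C (\<lambda>v. c v + - (if v \<in> S then 1 else 0)))"
      proof (cases "m \<in> D")
        case True
        then obtain w where w: "m = w + sqfree S" using split by blast
        then have "w \<in> C (\<lambda>v. c v + - (if v \<in> S then 1 else 0))"
          using m by (auto simp: C_def lookup_add lookup_sqfree [OF S(1)])
        then show ?thesis using True w by (simp add: T_def shift_down_def)
      qed (simp add: T_def shift_down_def)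
    qed
    then show ?thesis by (simp only: comp)
  qed
  ultimately show ?thesis unfolding Hom_comp_def T_def by (auto intro!: imageI)
qed

section \<open>Coefficients of derivations and of the maps they induce\<close>

lemma lookup_X_mult_eq_0: "v \<notin> keys m \<Longrightarrow> lookup (X v * f) m = 0"
  unfolding X_def by (rule lookup_monom_mult_eq_0) (auto simp: keys_exponent_add)

text \<open>In \<open>x_v d(u) + u d(x_v)\<close> the first summand has no term at \<open>u\<close>,
  since \<open>x_v\<close> does not divide \<open>u\<close>. Every such product thus reveals the
  same constant term, and two products can be played off against each other.\<close>

lemma derivation_shift_coeff:
  fixes d :: "('v, 'k::field) mpoly \<Rightarrow> ('v, 'k) mpoly"
  assumes d: "d \<in> derivations V" and v: "v \<in> V" and u: "u \<in> expo V" "v \<notin> keys u"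
  shows "lookup (d (monom (single v 1 + u))) u = lookup (d (X v)) 0"
proof -
  have "d (monom (single v 1 + u)) = X v * d (monom u) + monom u * d (X v)"
    using derivationsD(3) [OF d, of "X v" "monom u"] v u(1) by (simp add: X_def monom_add)
  moreover have "lookup (X v * d (monom u)) u = 0"
    using u(2) by (rule lookup_X_mult_eq_0)
  moreover have "lookup (monom u * d (X v)) u = lookup (d (X v)) 0"
    using lookup_monom_mult_add [of u "d (X v)" 0] by simp
  ultimately show ?thesis by (simp add: lookup_add)
qed

text \<open>Polynomials congruent modulo a monomial ideal have the same coefficients at exponents
  outside it.\<close>

lemma delta_star_lookup:
  assumes A: "up_closed V A" and d: "d \<in> derivations V"
    and eq: "(\<lambda>f\<in>polys A. coset V A (\<psi> f)) = delta_star V (polys A) d"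
    and f: "f \<in> polys A" "\<psi> f \<in> polys (expo V)" and m: "m \<notin> A"
  shows "lookup (d f) m = lookup (\<psi> f) m"
proof -
  have "coset V A (\<psi> f) = coset V A (d f)"
    using fun_cong [OF eq, of f] f(1) by (simp add: delta_star_def)
  then have "\<psi> f - d f \<in> polys A"
    using coset_eq_iff [OF A f(2) derivationsD(1) [OF d up_closed_polys [OF A f(1)]]] by simp
  then have "lookup (\<psi> f - d f) m = 0" using m by (auto simp: polys_def in_keys_iff)
  then show ?thesis by (simp add: lookup_minus)
qed

lemma empty_rigidE:
  fixes \<phi> :: "('v, 'k::field) mpoly \<Rightarrow> ('v, 'k) mpoly set"
  assumes "simplicial_complex V \<Delta>" "empty_rigid TYPE('k) V \<Delta>"
    and "\<phi> \<in> Hom_comp V (polys (nonface_expo V \<Delta>)) (\<lambda>v. - (if v \<in> S then 1 else 0))"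
  obtains d where "d \<in> derivations V" "\<phi> = delta_star V (polys (nonface_expo V \<Delta>)) d"
proof -
  have "(\<lambda>v. if v \<in> S then 1 else 0) \<in> V \<rightarrow> {0, 1 :: int}" by auto
  with assms(2) have "Hom_comp V (polys (nonface_expo V \<Delta>)) (\<lambda>v. - (if v \<in> S then 1 else 0)) \<subseteq>
      delta_star V (polys (nonface_expo V \<Delta>)) ` (derivations V :: (('v, 'k) mpoly \<Rightarrow> ('v, 'k) mpoly) set)"
    unfolding empty_rigid_iff [OF assms(1)] by (rule bspec)
  with assms(3) that show ?thesis by blast
qed

section \<open>Syzygies between variables\<close>

lemma syzygy_coeff:
  fixes f f' :: "('v, 'k::field) mpoly"
  assumes "X v' * f - X v * f' \<in> polys A" "single v' 1 + m \<notin> A"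
  shows "lookup f m = lookup (X v * f') (single v' 1 + m)"
proof -
  have "lookup (X v' * f - X v * f') (single v' 1 + m) = 0"
    using assms by (auto simp: polys_def in_keys_iff)
  then show ?thesis by (simp add: lookup_minus X_def)
qed

lemma syzygy_coeff_eq_0:
  fixes f f' :: "('v, 'k::field) mpoly"
  assumes "X v' * f - X v * f' \<in> polys A" "single v' 1 + m \<notin> A" "v' \<noteq> v" "v \<notin> keys m"
  shows "lookup f m = 0"
  using syzygy_coeff [OF assms(1,2)] assms(3,4)
  by (simp add: lookup_X_mult_eq_0 keys_exponent_add)

text \<open>No monomial in the variables of \<open>W\<close> lies in the ideal, so there the
  relations hold coefficient by coefficient and give all \<open>F v / X v\<close> a common value
  \<open>h\<close>. Divisibility by \<open>X v\<close> comes from a second variable or, if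
  \<open>W\<close> is a singleton, from the constant term.\<close>

lemma syzygy_solution:
  fixes F :: "'v \<Rightarrow> ('v, 'k::field) mpoly"
  assumes W: "W \<noteq> {}" "W \<subseteq> V" and WA: "\<And>m. m \<in> expo W \<Longrightarrow> m \<notin> A"
    and F: "\<And>v. v \<in> W \<Longrightarrow> F v \<in> polys (expo V)"
    and syz: "\<And>v v'. v \<in> W \<Longrightarrow> v' \<in> W \<Longrightarrow> X v' * F v - X v * F v' \<in> polys A"
    and const: "\<And>v. v \<in> W \<Longrightarrow> lookup (F v) 0 = 0"
  shows "\<exists>h \<in> polys (expo V). \<forall>v\<in>W. \<forall>m\<in>expo W. lookup (F v) m = lookup (X v * h) m"
proof -
  obtain w where w: "w \<in> W" using W(1) by blast
  \<comment> \<open>The quotient of \<open>F w\<close> by \<open>X w\<close>, with the terms free of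
    \<open>X w\<close> discarded.\<close>
  define h where "h = Poly_Mapping.map_key ((+) (single w 1)) (F w)"
  have "inj ((+) (single w (1::nat)))" by (simp add: inj_on_def)
  then have h_lookup: "lookup h u = lookup (F w) (single w 1 + u)" for u
    by (simp add: h_def map_key.rep_eq)
  have "h \<in> polys (expo V)"
    using F [OF w] by (auto simp: polys_def in_keys_iff h_lookup subset_iff)
  moreover have "lookup (F v) m = lookup (X v * h) m" if v: "v \<in> W" and m: "m \<in> expo W" for v m
  proof (cases "v \<in> keys m")
    case True
    then obtain u where u: "m = single v 1 + u" using keys_add_single [of v m] by auto
    have "lookup (F v) m = lookup (X v * F w) (single w 1 + m)"
      using syz [OF v w] by (rule syzygy_coeff) (use w m WA in auto)
    also have "\<dots> = lookup (X v * F w) (single v 1 + (single w 1 + u))"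
      by (simp only: u add.left_commute)
    finally show ?thesis by (simp add: X_def u h_lookup)
  next
    case False
    have "lookup (F v) m = 0"
    proof (cases "W = {v}")
      case True
      then have "keys m = {}" using m \<open>v \<notin> keys m\<close> unfolding expo_def by blast
      then show ?thesis using const [OF v] by simp
    next
      case False
      then obtain v' where "v' \<in> W" "v' \<noteq> v" using v by blast
      then show ?thesis
        using syzygy_coeff_eq_0 [OF syz [OF v \<open>v' \<in> W\<close>]] WA m \<open>v \<notin> keys m\<close> by simp
    qed
    then show ?thesis using False by (simp add: lookup_X_mult_eq_0)
  qed
  ultimately show ?thesis by blast
qed

section \<open>The criterion for rigidity\<close>

context disjoint_complexes
begin

lemma not_empty_rigid_if_not_simplex:
  assumes "\<Delta>\<^sub>1 \<noteq> Pow V\<^sub>1"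
  shows "\<not> empty_rigid TYPE('k::field) V \<Delta>"
proof
  assume rigid: "empty_rigid TYPE('k) V \<Delta>"
  obtain N where N: "N \<subseteq> V\<^sub>1" "N \<notin> \<Delta>\<^sub>1" "\<And>v. v \<in> N \<Longrightarrow> N - {v} \<in> \<Delta>\<^sub>1"
    by (rule minimal_nonface [OF sc1 assms]) blast
  obtain i where "i \<in> N" using nonface_ge_2 [OF N(1,2)] by blast
  then have i: "i \<in> V\<^sub>1" "i \<notin> V\<^sub>2" using N(1) disj by auto
  obtain q where q: "q \<in> V\<^sub>2" using V2_nonempty by blast
  then have q': "q \<notin> V\<^sub>1" "q \<noteq> i" using disj i by auto
  define A where "A = nonface_expo V \<Delta>"
  have A: "up_closed V A" unfolding A_def by (rule up_closed_nonface [OF simplicial_complex_union])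
  have mixed: "m \<in> A" if "m \<in> expo V" "p \<in> keys m" "p \<in> V\<^sub>1" "keys m \<inter> V\<^sub>2 \<noteq> {}" for m p
    using that faces(1) [of "keys m"] faces(2) [of "keys m"] disj
    by (auto simp: A_def nonface_expo_def)
  \<comment> \<open>The multiples of the \<open>x_i x_q\<close> with \<open>q\<close> in
    \<open>V\<^sub>2\<close>, on which division by \<open>x_i\<close> is to act.\<close>
  define D where "D = {m \<in> expo V. i \<in> keys m \<and> keys m \<inter> V\<^sub>2 \<noteq> {}}"
  define \<phi> :: "('v, 'k) mpoly \<Rightarrow> ('v, 'k) mpoly set"
    where "\<phi> = (\<lambda>f\<in>polys A. coset V A (lin (shift_down D (sqfree {i})) f))"
  have sq: "sqfree {v} = single v 1" for v :: 'v by (simp add: sqfree_def)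
  have "\<phi> \<in> Hom_comp V (polys A) (\<lambda>v. - (if v \<in> {i} then 1 else 0))"
    unfolding \<phi>_def
  proof (rule shift_in_Hom_comp [OF A])
    show "D \<subseteq> A" using mixed i by (auto simp: D_def)
    fix u m assume um: "u \<in> expo V" "m \<in> A" "m \<notin> D" "u + m \<in> D"
    then have "i \<in> keys (u + m)" "keys (u + m) \<inter> V\<^sub>2 \<noteq> {}" "u + m \<in> expo V" by (auto simp: D_def)
    \<comment> \<open>If \<open>x_i\<close> can be taken from \<open>u\<close>, the quotient is a
      multiple of \<open>m\<close>. Otherwise \<open>m\<close> is a nonface monomial on
      \<open>V\<^sub>1\<close>, and a second vertex \<open>p\<close> of it stays in the quotient
      beside a vertex of \<open>V\<^sub>2\<close>.\<close>
    show "u + m - sqfree {i} \<in> A"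
    proof (cases "i \<in> keys m")
      case False
      then have "i \<in> keys u" using \<open>i \<in> keys (u + m)\<close> by (simp add: keys_exponent_add)
      then obtain w where "u = single i 1 + w" using keys_add_single [of i u] by auto
      then show ?thesis using um A by (simp add: sq add.assoc up_closed_def)
    next
      case True
      obtain w where w: "u + m = single i 1 + w" using keys_add_single [OF \<open>i \<in> keys (u + m)\<close>] by auto
      have "m \<in> expo V" using um(2) A by (auto simp: up_closed_def)
      then have "keys m \<inter> V\<^sub>2 = {}" using um(3) True by (simp add: D_def)
      then have "keys m \<subseteq> V\<^sub>1" "keys m \<notin> \<Delta>\<^sub>1"
        using um(2) by (auto simp: A_def nonface_expo_def expo_def)
      then obtain p where p: "p \<in> keys m" "p \<noteq> i" "p \<in> V\<^sub>1" using nonface_ge_2(2) [of "keys m" i] by blast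
      have keys_w: "keys (u + m) = insert i (keys w)" unfolding w by (simp add: keys_exponent_add)
      have "p \<in> keys w" using p(1,2) keys_w by (auto simp: keys_exponent_add)
      moreover have "keys w \<inter> V\<^sub>2 \<noteq> {}" using \<open>keys (u + m) \<inter> V\<^sub>2 \<noteq> {}\<close> i(2) unfolding keys_w by blast
      moreover have "w \<in> expo V" using \<open>u + m \<in> expo V\<close> unfolding w by simp
      ultimately show ?thesis using mixed p(3) by (simp add: w sq)
    qed
  qed (use i in \<open>auto simp: D_def keys_exponent_add\<close>)
  then obtain d where d: "d \<in> derivations V" "\<phi> = delta_star V (polys A) d"
    unfolding A_def by (rule empty_rigidE [OF simplicial_complex_union rigid])
  note coeff = delta_star_lookup [OF A d(1) d(2) [unfolded \<phi>_def]]
  \<comment> \<open>First test: \<open>x_i x_q\<close> is sent to \<open>x_q\<close>, which is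
    nonzero modulo the ideal, so \<open>d (X i)\<close> has constant term 1.\<close>
  define e where "e = single i 1 + single q (1::nat)"
  have e: "e \<in> expo V" "keys e = {i, q}"
    using i q by (auto simp: e_def keys_exponent_add)
  have "e \<in> D" using e q by (simp add: D_def)
  have "e \<in> A" using mixed [OF e(1), of i] i q by (simp add: e(2))
  have "lookup (d (X i)) 0 = 1"
  proof -
    have "single q 1 \<notin> A" using vertices2 q by (simp add: A_def nonface_expo_def)
    then have "lookup (d (monom e)) (single q 1) = lookup (monom (single q 1) :: ('v, 'k) mpoly) (single q 1)"
      using coeff [of "monom e" "single q 1"] \<open>e \<in> D\<close> \<open>e \<in> A\<close> q
      by (simp add: shift_down_def sq e_def)
    then show ?thesis
      using derivation_shift_coeff [OF d(1), of i "single q 1"] i q q' by (simp add: lookup_monom e_def)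
  qed
  \<comment> \<open>Second test: the monomial on \<open>N\<close> is sent to 0. As
    \<open>N - {i}\<close> is a face, its coefficient survives in the quotient and forces constant
    term 0.\<close>
  moreover have "lookup (d (X i)) 0 = 0"
  proof -
    have fin: "finite N" using N(1) finite_V1 finite_subset by blast
    have eq: "sqfree N = single i 1 + sqfree (N - {i})"
      using sqfree_insert [of "N - {i}" i] fin \<open>i \<in> N\<close> by (simp add: insert_absorb)
    have "N \<inter> V\<^sub>2 = {}" using N(1) disj by blast
    then have "sqfree N \<notin> D" by (simp add: D_def keys_sqfree [OF fin])
    moreover have "N \<notin> \<Delta>\<^sub>2" using faces(2) \<open>i \<in> N\<close> i(2) by blast
    then have "sqfree N \<in> A"
      using N(1,2) by (auto simp: A_def nonface_expo_def keys_sqfree [OF fin] expo_def)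
    moreover have "sqfree (N - {i}) \<notin> A"
      using N(3) [OF \<open>i \<in> N\<close>] fin by (simp add: A_def nonface_expo_def keys_sqfree)
    ultimately have "lookup (d (monom (sqfree N))) (sqfree (N - {i})) = 0"
      using coeff [of "monom (sqfree N)" "sqfree (N - {i})"] by (simp add: shift_down_def)
    moreover have "sqfree (N - {i}) \<in> expo V" using N(1) fin by (auto simp: expo_def keys_sqfree)
    ultimately show ?thesis
      using derivation_shift_coeff [OF d(1), of i "sqfree (N - {i})"] i fin
      by (simp add: eq keys_sqfree)
  qed
  ultimately show False by simp
qed

text \<open>For two points the ideal is \<open>(x\<^sub>p x\<^sub>q)\<close>, and sending the generator to 1 smooths the node.\<close>

lemma not_empty_rigid_two_points:
  assumes V1: "V\<^sub>1 = {p}" and V2: "V\<^sub>2 = {q}"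
  shows "\<not> empty_rigid TYPE('k::field) V \<Delta>"
proof
  assume rigid: "empty_rigid TYPE('k) V \<Delta>"
  define A where "A = nonface_expo V \<Delta>"
  have A: "up_closed V A" unfolding A_def by (rule up_closed_nonface [OF simplicial_complex_union])
  have "p \<noteq> q" using disj V1 V2 by auto
  have faces1: "F \<in> \<Delta>\<^sub>1 \<longleftrightarrow> F \<subseteq> {p}" for F
    using faces(1) empty_face(1) vertices1 unfolding V1 by (auto simp: subset_singleton_iff)
  have faces2: "F \<in> \<Delta>\<^sub>2 \<longleftrightarrow> F \<subseteq> {q}" for F
    using faces(2) empty_face(2) vertices2 unfolding V2 by (auto simp: subset_singleton_iff)
  have A_iff: "m \<in> A \<longleftrightarrow> keys m = {p, q}" for m
    using \<open>p \<noteq> q\<close> by (auto simp: A_def nonface_expo_def expo_def faces1 faces2 V1 V2)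
  define \<phi> :: "('v, 'k) mpoly \<Rightarrow> ('v, 'k) mpoly set"
    where "\<phi> = (\<lambda>f\<in>polys A. coset V A (lin (shift_down A (sqfree {p, q})) f))"
  have "\<phi> \<in> Hom_comp V (polys A) (\<lambda>v. - (if v \<in> {p, q} then 1 else 0))"
    unfolding \<phi>_def
    by (rule shift_in_Hom_comp [OF A])
      (use A in \<open>auto simp: V1 V2 A_iff up_closed_def\<close>)
  then obtain d where d: "d \<in> derivations V" "\<phi> = delta_star V (polys A) d"
    unfolding A_def by (rule empty_rigidE [OF simplicial_complex_union rigid])
  have "sqfree {p, q} \<in> A" by (simp add: A_iff keys_sqfree)
  moreover have "0 \<notin> A" by (simp add: A_iff)
  ultimately have "lookup (d (monom (sqfree {p, q}))) 0 = 1"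
    using delta_star_lookup [OF A d(1) d(2) [unfolded \<phi>_def], of "monom (sqfree {p, q})" 0]
    by (simp add: shift_down_def one_in_polys)
  \<comment> \<open>Each summand of the Leibniz rule is divisible by a variable, so no derivation
    produces the constant 1.\<close>
  moreover have "d (monom (sqfree {p, q})) = X p * d (X q) + X q * d (X p)"
    using derivationsD(3) [OF d(1), of "X p" "X q"] \<open>p \<noteq> q\<close>
    by (simp add: V1 V2 sqfree_def X_def monom_add)
  moreover have "lookup (X v * f) 0 = 0" for v and f :: "('v, 'k) mpoly"
    by (simp add: lookup_X_mult_eq_0)
  ultimately show False by (simp add: lookup_add)
qed

lemma rigid_if_simplices:
  assumes simplices: "\<Delta>\<^sub>1 = Pow V\<^sub>1" "\<Delta>\<^sub>2 = Pow V\<^sub>2" and big: "\<not> (card V\<^sub>1 = 1 \<and> card V\<^sub>2 = 1)"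
  shows "rigid TYPE('k::field) V \<Delta>"
  unfolding rigid_iff [OF simplicial_complex_union]
proof
  define A where "A = nonface_expo V \<Delta>"
  have A: "up_closed V A" unfolding A_def by (rule up_closed_nonface [OF simplicial_complex_union])
  have A_iff: "m \<in> A \<longleftrightarrow> m \<in> expo V \<and> keys m \<inter> V\<^sub>1 \<noteq> {} \<and> keys m \<inter> V\<^sub>2 \<noteq> {}" for m
    unfolding A_def simplices by (rule nonface_simplices [OF disj])
  have A1: "m \<notin> A" if "keys m \<subseteq> V\<^sub>1" for m using that disj by (auto simp: A_iff)
  have A2: "m \<notin> A" if "keys m \<subseteq> V\<^sub>2" for m using that disj by (auto simp: A_iff)
  fix \<phi> :: "('v, 'k) mpoly \<Rightarrow> ('v, 'k) mpoly set"
  assume "\<phi> \<in> Homs V (nonface_expo V \<Delta>)"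
  then have \<phi>: "\<phi> \<in> Homs V A" by (simp add: A_def)
  have XV: "X v \<in> (polys (expo V) :: ('v, 'k) mpoly set)" if "v \<in> V" for v using that by simp
  have XX: "X p * X q \<in> (polys A :: ('v, 'k) mpoly set)" if "p \<in> V\<^sub>1" "q \<in> V\<^sub>2" for p q
    using that by (auto simp: X_def monom_add [symmetric] A_iff keys_exponent_add)
  have "\<exists>f. f \<in> polys (expo V) \<and> \<phi> (X p * X q) = coset V A f" if "p \<in> V\<^sub>1" "q \<in> V\<^sub>2" for p q
    using Hom_quotD(1) [OF \<phi> XX [OF that]] by (auto simp: quot_carrier)
  then obtain F where F: "\<And>p q. p \<in> V\<^sub>1 \<Longrightarrow> q \<in> V\<^sub>2 \<Longrightarrow> F p q \<in> polys (expo V)"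
    "\<And>p q. p \<in> V\<^sub>1 \<Longrightarrow> q \<in> V\<^sub>2 \<Longrightarrow> \<phi> (X p * X q) = coset V A (F p q)"
    by metis
  have mult: "\<phi> (X v * (X p * X q)) = coset V A (X v * F p q)"
    if "v \<in> V" "p \<in> V\<^sub>1" "q \<in> V\<^sub>2" for v p q
    using Hom_quotD(4) [OF \<phi> XV [OF that(1)] XX [OF that(2,3)]] F [OF that(2,3)]
      quot_ops(2) [OF A XV [OF that(1)] F(1) [OF that(2,3)]] by simp
  \<comment> \<open>Both products represent the value of \<open>\<phi>\<close> at
    \<open>x_p x_q x_q'\<close>.\<close>
  have rel2: "X q' * F p q - X q * F p q' \<in> polys A" if "p \<in> V\<^sub>1" "q \<in> V\<^sub>2" "q' \<in> V\<^sub>2" for p q q'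
  proof -
    have "coset V A (X q' * F p q) = \<phi> (X q' * (X p * X q))"
      by (rule mult [symmetric]) (use that in auto)
    also have "X q' * (X p * X q) = X q * (X p * (X q' :: ('v, 'k) mpoly))" by (simp add: ac_simps)
    also have "\<phi> \<dots> = coset V A (X q * F p q')"
      by (rule mult) (use that in auto)
    finally have "coset V A (X q' * F p q) = coset V A (X q * F p q')" .
    then show ?thesis
      using that by (subst (asm) coset_eq_iff [OF A]) (auto intro!: expo_polys_mult F(1))
  qed
  have rel1: "X p' * F p q - X p * F p' q \<in> polys A" if "p \<in> V\<^sub>1" "p' \<in> V\<^sub>1" "q \<in> V\<^sub>2" for p p' q
  proof -
    have "coset V A (X p' * F p q) = \<phi> (X p' * (X p * X q))"
      by (rule mult [symmetric]) (use that in auto)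
    also have "X p' * (X p * X q) = X p * (X p' * (X q :: ('v, 'k) mpoly))" by (simp add: ac_simps)
    also have "\<phi> \<dots> = coset V A (X p * F p' q)"
      by (rule mult) (use that in auto)
    finally have "coset V A (X p' * F p q) = coset V A (X p * F p' q)" .
    then show ?thesis
      using that by (subst (asm) coset_eq_iff [OF A]) (auto intro!: expo_polys_mult F(1))
  qed
  \<comment> \<open>A second vertex on either side supplies a relation that kills the constant term;
    \<open>big\<close> guarantees such a vertex.\<close>
  have const: "lookup (F p q) 0 = 0" if pq: "p \<in> V\<^sub>1" "q \<in> V\<^sub>2" for p q
  proof (cases "V\<^sub>2 = {q}")
    case False
    then obtain q' where "q' \<in> V\<^sub>2" "q' \<noteq> q" using pq(2) by blast
    then show ?thesis
      using syzygy_coeff_eq_0 [OF rel2, of p q q' 0] pq A2 by simp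
  next
    case True
    then have "V\<^sub>1 \<noteq> {p}" using big by auto
    then obtain p' where "p' \<in> V\<^sub>1" "p' \<noteq> p" using pq(1) by blast
    then show ?thesis
      using syzygy_coeff_eq_0 [OF rel1, of p p' q 0] pq A1 by simp
  qed
  \<comment> \<open>For fixed \<open>p\<close> the relations among the \<open>F p q\<close> govern
    their terms in the variables of \<open>V\<^sub>2\<close> alone; below, \<open>q\<close> is fixed
    and the roles are exchanged.\<close>
  have "\<exists>h \<in> polys (expo V). \<forall>q\<in>V\<^sub>2. \<forall>m\<in>expo V\<^sub>2. lookup (F p q) m = lookup (X q * h) m"
    if "p \<in> V\<^sub>1" for p
    by (rule syzygy_solution [where W = V\<^sub>2 and A = A]) (use that rel2 F(1) const V2_nonempty A2 in \<open>auto simp: expo_def\<close>)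
  then obtain h where h: "\<And>p. p \<in> V\<^sub>1 \<Longrightarrow> h p \<in> polys (expo V)"
    "\<And>p q m. p \<in> V\<^sub>1 \<Longrightarrow> q \<in> V\<^sub>2 \<Longrightarrow> m \<in> expo V\<^sub>2 \<Longrightarrow> lookup (F p q) m = lookup (X q * h p) m"
    by metis
  have "\<exists>k \<in> polys (expo V). \<forall>p\<in>V\<^sub>1. \<forall>m\<in>expo V\<^sub>1. lookup (F p q) m = lookup (X p * k) m"
    if "q \<in> V\<^sub>2" for q
    by (rule syzygy_solution [where W = V\<^sub>1 and A = A]) (use that rel1 F(1) const V1_nonempty A1 in \<open>auto simp: expo_def\<close>)
  then obtain k where k: "\<And>q. q \<in> V\<^sub>2 \<Longrightarrow> k q \<in> polys (expo V)"
    "\<And>p q m. p \<in> V\<^sub>1 \<Longrightarrow> q \<in> V\<^sub>2 \<Longrightarrow> m \<in> expo V\<^sub>1 \<Longrightarrow> lookup (F p q) m = lookup (X p * k q) m"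
    by metis
  \<comment> \<open>The coefficients of a vector field whose value at \<open>x_p x_q\<close> is
    \<open>x_p k_q + x_q h_p\<close>.\<close>
  define g where "g v = (if v \<in> V\<^sub>1 then h v else k v)" for v
  define d where "d = (\<lambda>f\<in>polys (expo V). vector_field V g f)"
  have g: "g v \<in> polys (expo V)" if "v \<in> V" for v using that h(1) k(1) by (auto simp: g_def)
  then have d: "d \<in> derivations V" unfolding d_def by (rule vector_field_derivation)
  have d_XX: "d (X p * X q) = X p * k q + X q * h p" if "p \<in> V\<^sub>1" "q \<in> V\<^sub>2" for p q
  proof -
    have "q \<notin> V\<^sub>1" using that disj by blast
    then show ?thesis
      using that expo_polys_mult [OF XV XV, of p q] finite_V1 finite_V2
      by (simp add: d_def vector_field_mult vector_field_X g_def)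
  qed
  have agree: "\<phi> (X p * X q) = delta_star V (polys A) d (X p * X q)" if "p \<in> V\<^sub>1" "q \<in> V\<^sub>2" for p q
  proof -
    define G where "G = X p * k q + X q * h p"
    have G: "G \<in> polys (expo V)"
      unfolding G_def using that h(1) k(1) by (intro polys_add expo_polys_mult) auto
    \<comment> \<open>A monomial outside the ideal involves only one of the vertex sets. On
      \<open>V\<^sub>1\<close> the summand \<open>x_q h_p\<close> has no such term and
      \<open>x_p k_q\<close> agrees with \<open>F p q\<close>; on \<open>V\<^sub>2\<close> it is the
      other way round.\<close>
    have "F p q - G \<in> polys A"
    proof -
      have "lookup (F p q - G) m = 0" if m: "m \<in> expo V" "m \<notin> A" for m
      proof (cases "keys m \<subseteq> V\<^sub>1")
        case True
        then have "q \<notin> keys m" using that disj \<open>q \<in> V\<^sub>2\<close> by blast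
        then have "lookup (X q * h p) m = 0" by (rule lookup_X_mult_eq_0)
        then show ?thesis
          using k(2) [OF \<open>p \<in> V\<^sub>1\<close> \<open>q \<in> V\<^sub>2\<close>, of m] True by (simp add: G_def lookup_minus lookup_add expo_def)
      next
        case False
        then have "keys m \<subseteq> V\<^sub>2" using m by (auto simp: A_iff expo_def)
        then have "p \<notin> keys m" using disj \<open>p \<in> V\<^sub>1\<close> by blast
        then have "lookup (X p * k q) m = 0" by (rule lookup_X_mult_eq_0)
        then show ?thesis
          using h(2) [OF \<open>p \<in> V\<^sub>1\<close> \<open>q \<in> V\<^sub>2\<close>, of m] \<open>keys m \<subseteq> V\<^sub>2\<close>
          by (simp add: G_def lookup_minus lookup_add expo_def)
      qed
      moreover have "F p q - G \<in> polys (expo V)" by (rule polys_diff [OF F(1) [OF that] G])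
      ultimately show ?thesis by (auto simp: polys_def in_keys_iff)
    qed
    then have "coset V A (F p q) = coset V A G" by (simp add: coset_eq_iff [OF A F(1) [OF that] G])
    then show ?thesis using XX [OF that] F(2) [OF that] d_XX [OF that] by (simp add: delta_star_def G_def)
  qed
  have "\<phi> = delta_star V (polys A) d"
  proof (rule Hom_quot_eqI [OF A \<phi> delta_star_in_Homs [OF A d]])
    fix m assume "m \<in> A"
    then obtain p q where pq: "p \<in> V\<^sub>1" "q \<in> V\<^sub>2" "p \<in> keys m" "q \<in> keys m" by (auto simp: A_iff)
    then have "p \<noteq> q" using disj by blast
    obtain u where "m = u + sqfree {p, q}" using sqfree_divides [of "{p, q}" m] pq by auto
    moreover have "monom (sqfree {p, q}) = X p * (X q :: ('v, 'k) mpoly)"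
      using \<open>p \<noteq> q\<close> by (simp add: prod_X [symmetric])
    moreover have "sqfree {p, q} \<in> A" using pq by (auto simp: A_iff keys_sqfree expo_def)
    ultimately show "\<exists>u g. m = u + g \<and> g \<in> A \<and> \<phi> (monom g) = delta_star V (polys A) d (monom g)"
      using agree pq by metis
  qed
  then show "\<phi> \<in> delta_star V (polys (nonface_expo V \<Delta>)) ` derivations V"
    using d unfolding A_def by blast
qed

lemma complex_dim_simplex:
  assumes "finite W" shows "complex_dim (Pow W) = int (card W) - 1"
proof -
  have "Max (card ` Pow W) = card W"
    using assms by (intro Max_eqI) (auto intro: card_mono)
  then show ?thesis by (simp add: complex_dim_def)
qed

text \<open>Both equivalences follow from a cycle: \<open>P\<close> implies rigidity, rigidity
  implies vanishing in the degrees \<open>-b\<close>, and this implies \<open>P\<close>.\<close>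

lemma rigidity_iff:
  defines "P \<equiv> is_simplex V\<^sub>1 \<Delta>\<^sub>1 \<and> is_simplex V\<^sub>2 \<Delta>\<^sub>2 \<and> complex_dim \<Delta>\<^sub>1 + complex_dim \<Delta>\<^sub>2 > 0"
  shows "rigid TYPE('k::field) V \<Delta> \<longleftrightarrow> P" "empty_rigid TYPE('k) V \<Delta> \<longleftrightarrow> P"
proof -
  \<comment> \<open>The vertex sets are nonempty, so both dimensions are nonnegative and their sum
    is positive unless both simplices are points.\<close>
  have dims: "complex_dim \<Delta>\<^sub>1 + complex_dim \<Delta>\<^sub>2 > 0 \<longleftrightarrow> \<not> (card V\<^sub>1 = 1 \<and> card V\<^sub>2 = 1)"
    if "\<Delta>\<^sub>1 = Pow V\<^sub>1" "\<Delta>\<^sub>2 = Pow V\<^sub>2"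
  proof -
    have "card V\<^sub>1 > 0" "card V\<^sub>2 > 0"
      using V1_nonempty V2_nonempty finite_V1 finite_V2 by (simp_all add: card_gt_0_iff)
    then show ?thesis by (simp add: that complex_dim_simplex finite_V1 finite_V2) linarith
  qed
  have "rigid TYPE('k) V \<Delta>" if P
    using that rigid_if_simplices dims unfolding P_def is_simplex_def by blast
  moreover have "empty_rigid TYPE('k) V \<Delta>" if "rigid TYPE('k) V \<Delta>"
    by (rule empty_rigid_if_rigid [OF simplicial_complex_union that])
  moreover have P if rigid: "empty_rigid TYPE('k) V \<Delta>"
  proof -
    have "\<Delta>\<^sub>1 = Pow V\<^sub>1" using not_empty_rigid_if_not_simplex rigid by blast
    moreover have "empty_rigid TYPE('k) (V\<^sub>2 \<union> V\<^sub>1) (\<Delta>\<^sub>2 \<union> \<Delta>\<^sub>1)"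
      using rigid by (simp only: Un_commute)
    then have "\<Delta>\<^sub>2 = Pow V\<^sub>2"
      using disjoint_complexes.not_empty_rigid_if_not_simplex [OF commute] by blast
    moreover have "\<not> (card V\<^sub>1 = 1 \<and> card V\<^sub>2 = 1)"
      using not_empty_rigid_two_points rigid by (metis card_1_singletonE)
    ultimately show ?thesis unfolding P_def is_simplex_def using dims by blast
  qed
  ultimately show "rigid TYPE('k) V \<Delta> \<longleftrightarrow> P" "empty_rigid TYPE('k) V \<Delta> \<longleftrightarrow> P" by blast+
qed

end

theorem theorem2p5:
  fixes V\<^sub>1 V\<^sub>2 :: "'v set" and \<Delta>\<^sub>1 \<Delta>\<^sub>2 :: "'v set set"
  assumes "simplicial_complex V\<^sub>1 \<Delta>\<^sub>1" and "simplicial_complex V\<^sub>2 \<Delta>\<^sub>2"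
    and "\<Delta>\<^sub>1 \<noteq> {{}}" and "\<Delta>\<^sub>2 \<noteq> {{}}"
    and "V\<^sub>1 \<inter> V\<^sub>2 = {}"
    and "\<forall>j\<in>V\<^sub>1. {j} \<in> \<Delta>\<^sub>1" and "\<forall>j\<in>V\<^sub>2. {j} \<in> \<Delta>\<^sub>2"
  shows "(inseparable TYPE('k::field) (V\<^sub>1 \<union> V\<^sub>2) (\<Delta>\<^sub>1 \<union> \<Delta>\<^sub>2) \<longleftrightarrow>
            is_simplex V\<^sub>1 \<Delta>\<^sub>1 \<and> is_simplex V\<^sub>2 \<Delta>\<^sub>2) \<and>
         (rigid TYPE('k) (V\<^sub>1 \<union> V\<^sub>2) (\<Delta>\<^sub>1 \<union> \<Delta>\<^sub>2) \<longleftrightarrow>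
            empty_rigid TYPE('k) (V\<^sub>1 \<union> V\<^sub>2) (\<Delta>\<^sub>1 \<union> \<Delta>\<^sub>2)) \<and>
         (empty_rigid TYPE('k) (V\<^sub>1 \<union> V\<^sub>2) (\<Delta>\<^sub>1 \<union> \<Delta>\<^sub>2) \<longleftrightarrow>
            is_simplex V\<^sub>1 \<Delta>\<^sub>1 \<and> is_simplex V\<^sub>2 \<Delta>\<^sub>2 \<and> complex_dim \<Delta>\<^sub>1 + complex_dim \<Delta>\<^sub>2 > 0)"
proof -
  interpret disjoint_complexes V\<^sub>1 V\<^sub>2 \<Delta>\<^sub>1 \<Delta>\<^sub>2
    using assms by (simp add: disjoint_complexes_def)
  show ?thesis
    using inseparable_iff [where 'k = 'k] rigidity_iff [where 'k = 'k] by simp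
qed

end
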